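(* The following statements hold for $\mathfrak g=\mathfrak{spo}(2m|2n+1)$ with $m,n>0$. (1) Suppose $m+n\ge4$. For the standard fundamental system, the Coxeter graph of $\widehat{\mathscr C}$ for $\mathfrak{spo}(2m|2n+1)$ is the chain $$\widehat r_{\bar1}\overset{4}{-}\widehat r_{\overline{12}}-\widehat r_{\overline{23}}-\cdots-\widehat r_{\overline{m-1,m}}\overset{12}{-}\widehat r_{\overline m1}\overset{12}{-}\widehat r_{12}-\widehat r_{23}-\cdots-\widehat r_{n-1,n}\overset{4}{-}\widehat r_n ,$$ in which the edge between $\widehat r_{\bar1}$ and $\widehat r_{\overline{12}}$ and the edge between $\widehat r_{n-1,n}$ and $\widehat r_n$ are labelled $4$, the edges joining $\widehat r_{\overline m1}$ to $\widehat r_{\overline{m-1,m}}$ and to $\widehat r_{12}$ are labelled $12$, and the remaining edges are unlabelled. (The graph is displayed in this general form.) (2) Suppose $m+n<4$. (2.1) For $\mathfrak{spo}(2|3)$ the Coxeter graph is $\widehat r_{\bar1}\overset4-\widehat r_{\bar11}\overset4-\widehat r_1$. (2.2) For $\mathfrak{spo}(2|5)$ the Coxeter graph is $\widehat r_{\bar1}\overset4-\widehat r_{\bar11}\overset{12}-\widehat r_{12}\overset4-\widehat r_2$. (2.3) For $\mathfrak{spo}(4|3)$ the Coxeter graph is $\widehat r_{\bar1}\overset4-\widehat r_{\overline{12}}\overset{12}-\widehat r_{\bar21}\overset4-\widehat r_1$.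
   Context: The ground field is algebraically closed of characteristic $0$. $\mathfrak h$ is the Cartan subalgebra of diagonal matrices; $\mathfrak h^*$ has basis $\delta_1,\dots,\delta_m,\varepsilon_1,\dots,\varepsilon_n$ with bilinear form $(\delta_i,\delta_i)=1$, $(\varepsilon_j,\varepsilon_j)=-1$, other pairings zero. Roots of $\mathfrak{spo}(2m|2n+1)$: even $\pm\delta_i\pm\delta_{i'}$ ($i\neq i'$), $\pm2\delta_i$, $\pm\varepsilon_j\pm\varepsilon_{j'}$ ($j\ne j'$), $\pm\varepsilon_j$; odd $\pm\delta_i\pm\varepsilon_j$ (isotropic) and $\pm\delta_i$ (non-isotropic). $\mathcal B$ is the (finite) set of Borel subalgebras containing $\mathfrak h$, identified with the set of fundamental (simple root) systems. For an isotropic odd root $\gamma$, the odd reflection $\widehat r_\gamma=\widehat r_{-\gamma}$ is the involution of $\mathcal B$ which sends $\Pi_1\ni\gamma$ to $\{-\gamma\}\cup\{\alpha\in\Pi_1: (\alpha,\gamma)=0,\alpha\ne\gamma\}\cup\{\alpha+\gamma:\alpha\in\Pi_1,(\alpha,\gamma)\neq0\}$, acts on $\Pi_1\ni-\gamma$ by the same rule with $-\gamma$ in place of $\gamma$, and fixes every fundamental system containing neither $\gamma$ nor $-\gamma$. For a non-isotropic root $\alpha$, $\widehat r_\alpha$ is the permutation of $\mathcal B$ induced by the ordinary reflection $s_\alpha$. The super Weyl group $\widehat W$ is the group of permutations of $\mathcal B$ generated by all odd and ordinary reflections. The standard fundamental system is $\Pi=\{\delta_1-\delta_2,\dots,\delta_{m-1}-\delta_m,\delta_m-\varepsilon_1,\varepsilon_1-\varepsilon_2,\dots,\varepsilon_{n-1}-\varepsilon_n,\varepsilon_n\}$;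 $\widetilde\Pi=\{-2\delta_1\}\cup\Pi$ and $\mathsf S_{\widetilde\Pi}=\{\widehat r_\theta:\theta\in\widetilde\Pi\}$, with $\widehat r_{\bar1}=\widehat r_{2\delta_1}=\widehat r_{-2\delta_1}$, $\widehat r_{\overline{i,i+1}}=\widehat r_{\delta_i-\delta_{i+1}}$ (so $\widehat r_{\overline{12}}=\widehat r_{\delta_1-\delta_2}$, etc.), $\widehat r_{\overline m1}=\widehat r_{\delta_m-\varepsilon_1}$ (so $\widehat r_{\bar11}=\widehat r_{\delta_1-\varepsilon_1}$ and $\widehat r_{\bar21}=\widehat r_{\delta_2-\varepsilon_1}$), $\widehat r_{j,j+1}=\widehat r_{\varepsilon_j-\varepsilon_{j+1}}$ (so $\widehat r_{12}=\widehat r_{\varepsilon_1-\varepsilon_2}$, etc.), $\widehat r_n=\widehat r_{\varepsilon_n}$. The Coxeter group $\widehat{\mathscr C}$ is $\langle x\in\mathsf S_{\widetilde\Pi}\mid (xy)^{m_{xy}}=1\rangle$ where $m_{xy}$ is the order of $xy$ in $\widehat W$. In its Coxeter graph, with vertex set $\mathsf S_{\widetilde\Pi}$, distinct $x,y$ are joined by an edge iff $m_{xy}\ge3$, labelled by $m_{xy}$ if $m_{xy}\ge4$ (no edge means $m_{xy}=2$, an unlabelled edge means $m_{xy}=3$). *)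

theory Defs
  imports
    "HOL-Library.Function_Algebras"
    "HOL-Computational_Algebra.Polynomial"
    "HOL-Algebra.Algebra"
begin

section \<open>The root system of spo(2m|2n+1)\<close>

text \<open>
  An element of \<open>\<hh>\<^sup>*\<close> is the function giving its coordinates in the basis
  \<open>\<delta>\<^sub>1, \<dots>, \<delta>\<^sub>m, \<epsilon>\<^sub>1, \<dots>, \<epsilon>\<^sub>n\<close>: \<open>Inl i\<close> is the index of \<open>\<delta>\<^sub>i\<close> and \<open>Inr j\<close> that
  of \<open>\<epsilon>\<^sub>j\<close>, both counted from 1. Coordinates outside this range are never used by the roots,
  so the same type serves all m and n.
\<close>

type_synonym 'k weight = "nat + nat \<Rightarrow> 'k"

definition \<delta> :: "nat \<Rightarrow> 'k::field_char_0 weight" where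
  "\<delta> i = (\<lambda>x. if x = Inl i then 1 else 0)"

definition \<epsilon> :: "nat \<Rightarrow> 'k::field_char_0 weight" where
  "\<epsilon> j = (\<lambda>x. if x = Inr j then 1 else 0)"

definition form :: "nat \<Rightarrow> nat \<Rightarrow> 'k::field_char_0 weight \<Rightarrow> 'k weight \<Rightarrow> 'k" where
  "form m n v w = (\<Sum>i=1..m. v (Inl i) * w (Inl i)) - (\<Sum>j=1..n. v (Inr j) * w (Inr j))"

definition pm :: "'a::uminus \<Rightarrow> 'a set" where
  "pm v = {v, - v}"

definition even_roots :: "nat \<Rightarrow> nat \<Rightarrow> 'k::field_char_0 weight set" where
  "even_roots m n =
     {a + b | a b. \<exists>i\<in>{1..m}. \<exists>i'\<in>{1..m}. i \<noteq> i' \<and> a \<in> pm (\<delta> i) \<and> b \<in> pm (\<delta> i')}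
   \<union> {a + a | a. \<exists>i\<in>{1..m}. a \<in> pm (\<delta> i)}
   \<union> {a + b | a b. \<exists>j\<in>{1..n}. \<exists>j'\<in>{1..n}. j \<noteq> j' \<and> a \<in> pm (\<epsilon> j) \<and> b \<in> pm (\<epsilon> j')}
   \<union> (\<Union>j\<in>{1..n}. pm (\<epsilon> j))"

definition isotropic_odd_roots :: "nat \<Rightarrow> nat \<Rightarrow> 'k::field_char_0 weight set" where
  "isotropic_odd_roots m n =
     {a + b | a b. \<exists>i\<in>{1..m}. \<exists>j\<in>{1..n}. a \<in> pm (\<delta> i) \<and> b \<in> pm (\<epsilon> j)}"

definition nonisotropic_odd_roots :: "nat \<Rightarrow> nat \<Rightarrow> 'k::field_char_0 weight set" where
  "nonisotropic_odd_roots m n = (\<Union>i\<in>{1..m}. pm (\<delta> i))"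

definition roots :: "nat \<Rightarrow> nat \<Rightarrow> 'k::field_char_0 weight set" where
  "roots m n = even_roots m n \<union> isotropic_odd_roots m n \<union> nonisotropic_odd_roots m n"


section \<open>Borel subalgebras as fundamental systems\<close>

text \<open>
  A Borel subalgebra containing \<open>\<hh>\<close> is \<open>\<hh> \<oplus> \<Oplus>\<^bsub>\<alpha> \<in> P\<^esub> \<gg>\<^sub>\<alpha>\<close> for a positive system P,
  the set of roots on which a regular real functional is positive. The ground field carries no
  order, so functionals are additive maps from \<open>\<hh>\<^sup>*\<close> to the reals. Only their values on the root
  lattice matter, and since the reals form a divisible group every homomorphism from the root
  lattice to the reals extends to such a map; hence these are the usual positive systems.
\<close>

definition positive_systems :: "nat \<Rightarrow> nat \<Rightarrow> 'k::field_char_0 weight set set" where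
  "positive_systems m n =
     {{\<alpha> \<in> roots m n. \<phi> \<alpha> > 0} | \<phi> :: 'k weight \<Rightarrow> real.
        additive \<phi> \<and> (\<forall>\<alpha>\<in>roots m n. \<phi> \<alpha> \<noteq> 0)}"

definition simple_roots :: "'k::field_char_0 weight set \<Rightarrow> 'k weight set" where
  "simple_roots P = {\<alpha> \<in> P. \<not> (\<exists>\<beta>\<in>P. \<exists>\<gamma>\<in>P. \<alpha> = \<beta> + \<gamma>)}"

definition borels :: "nat \<Rightarrow> nat \<Rightarrow> 'k::field_char_0 weight set set" where
  "borels m n = simple_roots ` positive_systems m n"


section \<open>Odd and ordinary reflections, and the super Weyl group\<close>

type_synonym 'k borel_map = "'k weight set \<Rightarrow> 'k weight set"

definition odd_move ::
    "nat \<Rightarrow> nat \<Rightarrow> 'k::field_char_0 weight \<Rightarrow> 'k weight set \<Rightarrow> 'k weight set" where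
  "odd_move m n \<gamma> B =
     {- \<gamma>} \<union> {\<alpha> \<in> B. form m n \<alpha> \<gamma> = 0 \<and> \<alpha> \<noteq> \<gamma>} \<union> {\<alpha> + \<gamma> | \<alpha>. \<alpha> \<in> B \<and> form m n \<alpha> \<gamma> \<noteq> 0}"

definition odd_reflection ::
    "nat \<Rightarrow> nat \<Rightarrow> 'k::field_char_0 weight \<Rightarrow> 'k weight set \<Rightarrow> 'k weight set" where
  "odd_reflection m n \<gamma> B =
     (if \<gamma> \<in> B then odd_move m n \<gamma> B
      else if - \<gamma> \<in> B then odd_move m n (- \<gamma>) B
      else B)"

definition reflection ::
    "nat \<Rightarrow> nat \<Rightarrow> 'k::field_char_0 weight \<Rightarrow> 'k weight \<Rightarrow> 'k weight" where
  "reflection m n \<alpha> v = (\<lambda>x. v x - 2 * form m n v \<alpha> / form m n \<alpha> \<alpha> * \<alpha> x)"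

text \<open>The \<open>restrict\<close> is required by \<open>Bij\<close>, whose elements are extensional functions.\<close>

definition r_hat :: "nat \<Rightarrow> nat \<Rightarrow> 'k::field_char_0 weight \<Rightarrow> 'k borel_map" where
  "r_hat m n \<alpha> =
     restrict (if \<alpha> \<in> isotropic_odd_roots m n then odd_reflection m n \<alpha>
               else (`) (reflection m n \<alpha>))
       (borels m n)"

definition super_weyl_group :: "nat \<Rightarrow> nat \<Rightarrow> 'k::field_char_0 borel_map monoid" where
  "super_weyl_group m n = subgroup_generated (BijGroup (borels m n)) (r_hat m n ` roots m n)"


section \<open>Coxeter graphs\<close>

text \<open>
  Each edge is stored with its label, \<open>None\<close> for an unlabelled edge.
\<close>

record 'v labelled_graph =
  verts :: "'v set"
  edges :: "('v set \<times> nat option) set"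

text \<open>
  The Coxeter graph of the Coxeter group \<open>\<langle>x \<in> S | (x y)\<^bsup>M x y\<^esup> = 1\<rangle>\<close>, for a matrix \<open>M\<close> with
  finite entries.
\<close>

definition coxeter_graph :: "'v set \<Rightarrow> ('v \<Rightarrow> 'v \<Rightarrow> nat) \<Rightarrow> 'v labelled_graph" where
  "coxeter_graph S M =
     \<lparr>verts = S,
      edges = {({x, y}, if M x y \<ge> 4 then Some (M x y) else None) | x y.
                 x \<in> S \<and> y \<in> S \<and> x \<noteq> y \<and> M x y \<ge> 3}\<rparr>"

text \<open>
  \<open>is_chain G vs ls\<close>: \<open>G\<close> is the path through the pairwise distinct vertices \<open>vs\<close>, and
  \<open>ls ! k\<close> is the label of the edge between \<open>vs ! k\<close> and \<open>vs ! (k + 1)\<close>.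
\<close>

definition is_chain :: "'v labelled_graph \<Rightarrow> 'v list \<Rightarrow> nat option list \<Rightarrow> bool" where
  "is_chain G vs ls \<longleftrightarrow>
     distinct vs \<and> length vs = length ls + 1 \<and>
     G = \<lparr>verts = set vs,
          edges = {({vs ! k, vs ! (k + 1)}, ls ! k) | k. k < length ls}\<rparr>"


section \<open>The Coxeter group attached to the standard fundamental system\<close>

definition standard_system :: "nat \<Rightarrow> nat \<Rightarrow> 'k::field_char_0 weight set" where
  "standard_system m n =
     {\<delta> i - \<delta> (i + 1) | i. i \<in> {1..<m}} \<union> {\<delta> m - \<epsilon> 1}
   \<union> {\<epsilon> j - \<epsilon> (j + 1) | j. j \<in> {1..<n}} \<union> {\<epsilon> n}"

definition extended_system :: "nat \<Rightarrow> nat \<Rightarrow> 'k::field_char_0 weight set" where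
  "extended_system m n = {- (\<delta> 1 + \<delta> 1)} \<union> standard_system m n"

definition coxeter_generators :: "nat \<Rightarrow> nat \<Rightarrow> 'k::field_char_0 borel_map set" where
  "coxeter_generators m n = r_hat m n ` extended_system m n"

text \<open>
  \<open>group.ord\<close> is 0 on elements of infinite order; these do not occur, since \<open>borels m n\<close> is
  finite.
\<close>

definition coxeter_matrix ::
    "nat \<Rightarrow> nat \<Rightarrow> 'k::field_char_0 borel_map \<Rightarrow> 'k borel_map \<Rightarrow> nat" where
  "coxeter_matrix m n x y =
     group.ord (super_weyl_group m n) (x \<otimes>\<^bsub>super_weyl_group m n\<^esub> y)"

definition spo_coxeter_graph :: "nat \<Rightarrow> nat \<Rightarrow> 'k::field_char_0 borel_map labelled_graph" where
  "spo_coxeter_graph m n = coxeter_graph (coxeter_generators m n) (coxeter_matrix m n)"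

definition r_bar1 :: "nat \<Rightarrow> nat \<Rightarrow> 'k::field_char_0 borel_map" where
  "r_bar1 m n = r_hat m n (\<delta> 1 + \<delta> 1)"

definition r_\<delta>\<delta> :: "nat \<Rightarrow> nat \<Rightarrow> nat \<Rightarrow> 'k::field_char_0 borel_map" where
  "r_\<delta>\<delta> m n i = r_hat m n (\<delta> i - \<delta> (i + 1))"

definition r_\<delta>\<epsilon> :: "nat \<Rightarrow> nat \<Rightarrow> 'k::field_char_0 borel_map" where
  "r_\<delta>\<epsilon> m n = r_hat m n (\<delta> m - \<epsilon> 1)"

definition r_\<epsilon>\<epsilon> :: "nat \<Rightarrow> nat \<Rightarrow> nat \<Rightarrow> 'k::field_char_0 borel_map" where
  "r_\<epsilon>\<epsilon> m n j = r_hat m n (\<epsilon> j - \<epsilon> (j + 1))"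

definition r_last :: "nat \<Rightarrow> nat \<Rightarrow> 'k::field_char_0 borel_map" where
  "r_last m n = r_hat m n (\<epsilon> n)"

end

theory Submission
  imports Defs
begin

text \<open>
  A Borel subalgebra containing \<open>\<hh>\<close> amounts to a total order, with signs, on the \<open>N = m + n\<close> basis
  vectors \<open>\<delta>\<^sub>i\<close>, \<open>\<epsilon>\<^sub>j\<close>: list the vectors \<open>\<plusminus>\<delta>\<^sub>i\<close>, \<open>\<plusminus>\<epsilon>\<^sub>j\<close> on which a regular functional is positive in
  increasing order as \<open>l\<^sub>1, \<dots>, l\<^sub>N\<close> and put \<open>l\<^sub>0 = 0\<close>; the simple roots are then \<open>l\<^sub>h\<^sub>+\<^sub>1 - l\<^sub>h\<close>. The
  order is recorded by the height function \<open>f\<close> that gives the \<open>k\<close>-th basis vector the value \<open>h\<close>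
  or \<open>-h\<close> if it is \<open>l\<^sub>h\<close> or \<open>-l\<^sub>h\<close>; the simple roots are exactly the roots of height 1. So the
  set of Borel subalgebras is in bijection with the integer functions \<open>f\<close> on \<open>{1..N}\<close> for which
  \<open>\<bar>f\<bar>\<close> permutes \<open>{1..N}\<close> (\<open>borels_eq\<close>, \<open>base_inj\<close>).

  In these terms the generators are elementary (\<open>r_hat_base\<close>). The reflections in \<open>2\<delta>\<^sub>1\<close> and \<open>\<epsilon>\<^sub>n\<close>
  change the sign of the first and of the last value of \<open>f\<close>, and the reflections in
  \<open>\<delta>\<^sub>i - \<delta>\<^sub>i\<^sub>+\<^sub>1\<close> and \<open>\<epsilon>\<^sub>j - \<epsilon>\<^sub>j\<^sub>+\<^sub>1\<close> exchange the values at two consecutive positions. The odd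
  reflection in \<open>\<delta>\<^sub>m - \<epsilon>\<^sub>1\<close> exchanges the values at positions \<open>m\<close> and \<open>m + 1\<close> if they differ by
  exactly 1, that is, if the two vectors are adjacent in the order and occur with the same sign,
  and does nothing otherwise.

  The product of two generators therefore only moves two, three or four values, and its order can
  be read off from those. Generators that are not consecutive in the chain concern disjoint
  positions; they commute, and their product has order 2. Two even exchanges with one position in
  common compose to a 3-cycle. A sign change and an adjacent exchange, odd or not, give order 4.
  The number 12 arises for an exchange \<open>a \<leftrightarrow> b\<close> and an odd exchange \<open>b \<leftrightarrow> c\<close>: two
  involutions act on each orbit of the group they generate as on a path or a cycle, and here an
  orbit can be a path with 6 vertices (three consecutive heights) or with 4 vertices (two
  consecutive heights and a third apart from both). On such a path the product is a 6-cycle or a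
  4-cycle, and 12 is the least common multiple (\<open>order_swap_odd_swap\<close>).

  None of this depends on the size of \<open>m + n\<close>, so the graphs of the three small algebras are
  instances of the general chain.
\<close>

section \<open>Signed arrangements and the moves between them\<close>

text \<open>
  This is the order of \<open>T\<close> as a permutation of \<open>S\<close>, in the divisibility form that determines
  \<open>group.ord\<close>.
\<close>

definition has_order :: "'a set \<Rightarrow> ('a \<Rightarrow> 'a) \<Rightarrow> nat \<Rightarrow> bool" where
  "has_order S T d \<longleftrightarrow> (\<forall>p. (\<forall>x\<in>S. (T ^^ p) x = x) \<longleftrightarrow> d dvd p)"

lemma has_orderI:
  assumes "d > 0"
    and period: "\<And>x. x \<in> S \<Longrightarrow> (T ^^ d) x = x"
    and minimal: "\<And>p. 0 < p \<Longrightarrow> p < d \<Longrightarrow> \<exists>x\<in>S. (T ^^ p) x \<noteq> x"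
  shows "has_order S T d"
  unfolding has_order_def
proof (intro allI iffI ballI)
  fix p assume fixed: "\<forall>x\<in>S. (T ^^ p) x = x"
  have "\<forall>x\<in>S. (T ^^ (p mod d)) x = x"
    using fixed funpow_mod_eq[OF period] by metis
  then have "p mod d = 0"
    using minimal[of "p mod d"] \<open>d > 0\<close> by (metis mod_less_divisor neq0_conv)
  then show "d dvd p"
    by auto
next
  fix p x assume "d dvd p" "x \<in> S"
  then show "(T ^^ p) x = x"
    using funpow_mod_eq[OF period, of x p] by (simp add: dvd_eq_mod_eq_0)
qed

text \<open>
  Height functions vanish outside \<open>{1..N}\<close>, so that equality of two of them is equality of the
  arrangements they describe.
\<close>

definition heights :: "nat \<Rightarrow> (nat \<Rightarrow> int) set" where
  "heights N = {f. (\<forall>k. k \<notin> {1..N} \<longrightarrow> f k = 0) \<and> bij_betw (\<lambda>k. \<bar>f k\<bar>) {1..N} {1..int N}}"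

definition flip :: "nat \<Rightarrow> (nat \<Rightarrow> int) \<Rightarrow> nat \<Rightarrow> int" where
  "flip a f = f(a := - f a)"

definition swap :: "nat \<Rightarrow> nat \<Rightarrow> (nat \<Rightarrow> int) \<Rightarrow> nat \<Rightarrow> int" where
  "swap a b f = f(a := f b, b := f a)"

definition neighbours :: "int \<Rightarrow> int \<Rightarrow> bool" where
  "neighbours p q \<longleftrightarrow> \<bar>p - q\<bar> = 1"

text \<open>
  Heights are nonzero, so two values that differ by 1 have the same sign. The condition thus says
  that the two vectors are adjacent in the order and enter it with equal signs.
\<close>

definition odd_swap :: "nat \<Rightarrow> nat \<Rightarrow> (nat \<Rightarrow> int) \<Rightarrow> nat \<Rightarrow> int" where
  "odd_swap a b f = (if neighbours (f a) (f b) then swap a b f else f)"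

lemma neighbours_commute: "neighbours p q \<longleftrightarrow> neighbours q p"
  by (auto simp: neighbours_def)

text \<open>
  Integers that differ by 1 have opposite parity, and no three integers have pairwise opposite
  parities.
\<close>

lemma neighbours_triangle: "\<not> (neighbours p q \<and> neighbours q r \<and> neighbours p r)"
  by (auto simp: neighbours_def)

lemma neighbours_minus: "neighbours (- p) (- q) \<longleftrightarrow> neighbours p q"
  by (auto simp: neighbours_def)

lemma swap_commute: "swap a b = swap b a"
  by (auto simp: swap_def fun_eq_iff)

lemma odd_swap_commute: "odd_swap a b = odd_swap b a"
  by (auto simp: odd_swap_def swap_commute[of a b] neighbours_commute fun_eq_iff)

lemma heights_nonzero: "f \<in> heights N \<Longrightarrow> k \<in> {1..N} \<Longrightarrow> f k \<noteq> 0"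
  unfolding heights_def bij_betw_def by force

lemma heights_abs_eq:
  "f \<in> heights N \<Longrightarrow> i \<in> {1..N} \<Longrightarrow> j \<in> {1..N} \<Longrightarrow> \<bar>f i\<bar> = \<bar>f j\<bar> \<longleftrightarrow> i = j"
  unfolding heights_def bij_betw_def inj_on_def by blast

lemma heights_outside: "f \<in> heights N \<Longrightarrow> k \<notin> {1..N} \<Longrightarrow> f k = 0"
  unfolding heights_def by blast

lemma flip_heights: "f \<in> heights N \<Longrightarrow> a \<in> {1..N} \<Longrightarrow> flip a f \<in> heights N"
proof -
  assume *: "f \<in> heights N" "a \<in> {1..N}"
  have "(\<lambda>k. \<bar>flip a f k\<bar>) = (\<lambda>k. \<bar>f k\<bar>)"
    by (auto simp: flip_def)
  with * show ?thesis
    by (auto simp: heights_def flip_def)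
qed

lemma swap_heights:
  assumes "f \<in> heights N" "a \<in> {1..N}" "b \<in> {1..N}"
  shows "swap a b f \<in> heights N"
proof -
  have "(\<lambda>k. \<bar>swap a b f k\<bar>) = (\<lambda>k. \<bar>f k\<bar>) \<circ> transpose a b"
    by (auto simp: swap_def fun_eq_iff transpose_def)
  moreover have "bij_betw (transpose a b) {1..N} {1..N}"
    using assms by (simp add: bij_betw_transpose_iff)
  ultimately show ?thesis
    using assms bij_betw_trans[of "transpose a b" "{1..N}" "{1..N}" "\<lambda>k. \<bar>f k\<bar>"]
    by (auto simp: heights_def swap_def)
qed

lemma odd_swap_heights:
  "f \<in> heights N \<Longrightarrow> a \<in> {1..N} \<Longrightarrow> b \<in> {1..N} \<Longrightarrow> odd_swap a b f \<in> heights N"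
  by (simp add: odd_swap_def swap_heights)

text \<open>
  Since the unused indices and the unused absolute values are equally many, prescribed values at
  a few positions extend to a full arrangement. This reduces lower bounds for orders to a choice
  of two or three integers.
\<close>

lemma heights_extend:
  assumes A: "A \<subseteq> {1..N}" and inj: "inj_on (\<lambda>k. \<bar>g k\<bar>) A" and img: "(\<lambda>k. \<bar>g k\<bar>) ` A \<subseteq> {1..int N}"
  shows "\<exists>f\<in>heights N. \<forall>a\<in>A. f a = g a"
proof -
  let ?g = "\<lambda>k. \<bar>g k\<bar>"
  have fin: "finite A" using A by (rule finite_subset) simp
  have "card ({1..N} - A) = card ({1..int N} - ?g ` A)"
    using A img fin by (simp add: card_Diff_subset card_image[OF inj])
  then obtain h where h: "bij_betw h ({1..N} - A) ({1..int N} - ?g ` A)"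
    using finite_same_card_bij[of "{1..N} - A" "{1..int N} - ?g ` A"] by auto
  define f where "f = (\<lambda>k. if k \<in> A then g k else if k \<in> {1..N} then h k else 0)"
  have "bij_betw (\<lambda>k. \<bar>f k\<bar>) A (?g ` A)"
    using inj by (auto simp: bij_betw_def f_def inj_on_def)
  moreover have "bij_betw (\<lambda>k. \<bar>f k\<bar>) ({1..N} - A) ({1..int N} - ?g ` A)"
  proof -
    have "\<bar>f k\<bar> = h k" if "k \<in> {1..N} - A" for k
      using that bij_betw_apply[OF h that] by (auto simp: f_def)
    then show ?thesis using h by (metis (no_types, lifting) bij_betw_cong)
  qed
  ultimately have "bij_betw (\<lambda>k. \<bar>f k\<bar>) (A \<union> ({1..N} - A)) (?g ` A \<union> ({1..int N} - ?g ` A))"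
    by (rule bij_betw_combine) auto
  moreover have "A \<union> ({1..N} - A) = {1..N}" "?g ` A \<union> ({1..int N} - ?g ` A) = {1..int N}"
    using A img by auto
  ultimately have "f \<in> heights N"
    using A by (auto simp: heights_def f_def)
  then show ?thesis by (auto simp: f_def intro!: bexI[of _ f])
qed

lemma heights_extend_pair:
  assumes "a \<in> {1..N}" "b \<in> {1..N}" "a \<noteq> b"
    and "\<bar>p\<bar> \<in> {1..int N}" "\<bar>q\<bar> \<in> {1..int N}" "\<bar>p\<bar> \<noteq> \<bar>q\<bar>"
  shows "\<exists>f\<in>heights N. f a = p \<and> f b = q"
  using heights_extend[of "{a, b}" N "\<lambda>k. if k = a then p else q"] assms by auto

lemma heights_extend_triple:
  assumes "a \<in> {1..N}" "b \<in> {1..N}" "c \<in> {1..N}" "distinct [a, b, c]"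
    and "\<bar>p\<bar> \<in> {1..int N}" "\<bar>q\<bar> \<in> {1..int N}" "\<bar>r\<bar> \<in> {1..int N}" "distinct [\<bar>p\<bar>, \<bar>q\<bar>, \<bar>r\<bar>]"
  shows "\<exists>f\<in>heights N. f a = p \<and> f b = q \<and> f c = r"
  using heights_extend[of "{a, b, c}" N "\<lambda>k. if k = a then p else if k = b then q else r"] assms
  by auto

text \<open>
  A move that changes only the positions in \<open>A\<close>, and changes them according to the values there
  alone, has the order of its action \<open>U\<close> on the tuple of these values.
\<close>

lemma has_order_heightsI:
  assumes "d > 0"
    and loc: "\<And>f k. k \<notin> A \<Longrightarrow> T f k = f k"
    and val: "\<And>f g. val f = val g \<Longrightarrow> \<forall>k\<in>A. f k = g k"
    and step: "\<And>f. val (T f) = U (val f)"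
    and period: "\<And>f. f \<in> heights N \<Longrightarrow> (U ^^ d) (val f) = val f"
    and minimal: "\<And>p. 0 < p \<Longrightarrow> p < d \<Longrightarrow> \<exists>f\<in>heights N. (U ^^ p) (val f) \<noteq> val f"
  shows "has_order (heights N) T d"
proof (rule has_orderI)
  have steps: "val ((T ^^ p) f) = (U ^^ p) (val f)" for p f
    by (induction p) (simp_all add: step)
  have outside: "k \<notin> A \<Longrightarrow> (T ^^ p) f k = f k" for p f k
    by (induction p) (simp_all add: loc)
  show "(T ^^ d) f = f" if "f \<in> heights N" for f
    using val[of "(T ^^ d) f" f] outside period[OF that] steps[of d f] by (metis ext)
  show "\<exists>f\<in>heights N. (T ^^ p) f \<noteq> f" if "0 < p" "p < d" for p
    using minimal[OF that] steps[of p] by metis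
qed fact

lemma less_numeral_cases:
  "0 < p \<Longrightarrow> (p::nat) < 3 \<Longrightarrow> p \<in> {1, 2}"
  "0 < p \<Longrightarrow> (p::nat) < 4 \<Longrightarrow> p \<in> {1, 2, 3}"
  "0 < p \<Longrightarrow> (p::nat) < 12 \<Longrightarrow> p \<in> {1, 2, 3, 4, 5, 6, 7, 8, 9, 10, 11}"
  by (auto simp: eval_nat_numeral less_Suc_eq)

lemma order_swap_swap:
  assumes abc: "a \<in> {1..N}" "b \<in> {1..N}" "c \<in> {1..N}" and d: "distinct [a, b, c]"
  shows "has_order (heights N) (swap a b \<circ> swap b c) 3"
proof (rule has_order_heightsI[where A = "{a, b, c}" and val = "\<lambda>f. (f a, f b, f c)"
      and U = "\<lambda>(p, q, r). (r, p, q)"])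
  fix p :: nat assume p: "0 < p" "p < 3"
  have "card {a, b, c} \<le> card {1..N}" using abc by (intro card_mono) auto
  then have "N \<ge> 3" using d by simp
  then obtain f where f: "f \<in> heights N" "f a = 1" "f b = 2" "f c = 3"
    using heights_extend_triple[OF assms, of 1 2 3] by auto
  then show "\<exists>f\<in>heights N. ((\<lambda>(p, q, r). (r, p, q)) ^^ p) (f a, f b, f c) \<noteq> (f a, f b, f c)"
    using less_numeral_cases(1)[OF p] by (auto simp: eval_nat_numeral intro!: bexI[of _ f])
qed (use d in \<open>auto simp: swap_def eval_nat_numeral\<close>)

text \<open>
  The moves permute the three values, so their effect depends only on which pairs of values are
  neighbours. At most two of the three pairs are, and in each of these cases 12 is a period. It is
  minimal because the triple \<open>(1, 2, 3)\<close>,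
  with three consecutive heights, has an orbit of length 6, while \<open>(-3, 1, 2)\<close>, with the value at
  \<open>a\<close> set apart by its sign, has an orbit of length 4.
\<close>

lemma order_swap_odd_swap:
  assumes abc: "a \<in> {1..N}" "b \<in> {1..N}" "c \<in> {1..N}" and d: "distinct [a, b, c]"
  shows "has_order (heights N) (swap a b \<circ> odd_swap b c) 12"
proof -
  define U :: "int \<times> int \<times> int \<Rightarrow> int \<times> int \<times> int"
    where "U = (\<lambda>(p, q, r). if neighbours q r then (r, p, q) else (q, p, r))"
  have U: "U (p, q, r) = (if neighbours q r then (r, p, q) else (q, p, r))" for p q r
    by (simp add: U_def)
  show ?thesis
  proof (rule has_order_heightsI[where A = "{a, b, c}" and val = "\<lambda>f. (f a, f b, f c)" and U = U])
    show "(U ^^ 12) (f a, f b, f c) = (f a, f b, f c)" for f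
    proof -
      consider "\<not> neighbours (f a) (f b)" | "\<not> neighbours (f b) (f c)" | "\<not> neighbours (f a) (f c)"
        using neighbours_triangle by blast
      then show ?thesis
        by cases (cases "neighbours (f a) (f b)"; cases "neighbours (f b) (f c)"; cases "neighbours (f a) (f c)";
            simp add: U eval_nat_numeral neighbours_commute[of "f b" "f a"]
              neighbours_commute[of "f c" "f b"] neighbours_commute[of "f c" "f a"])+
    qed
    fix p :: nat assume p: "0 < p" "p < 12"
    have "card {a, b, c} \<le> card {1..N}" using abc by (intro card_mono) auto
    then have N: "N \<ge> 3" using d by simp
    obtain f where f: "f \<in> heights N" "f a = 1" "f b = 2" "f c = 3"
      using heights_extend_triple[OF assms, of 1 2 3] N by auto
    obtain g where g: "g \<in> heights N" "g a = -3" "g b = 1" "g c = 2"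
      using heights_extend_triple[OF assms, of "-3" 1 2] N by auto
    have "(U ^^ p) (1, 2, 3) \<noteq> (1, 2, 3) \<or> (U ^^ p) (-3, 1, 2) \<noteq> (-3, 1, 2)"
      using less_numeral_cases(3)[OF p] by (auto simp: U eval_nat_numeral neighbours_def)
    then show "\<exists>f\<in>heights N. (U ^^ p) (f a, f b, f c) \<noteq> (f a, f b, f c)"
      using f g by metis
  qed (use d in \<open>auto simp: U odd_swap_def swap_def\<close>)
qed

lemma order_flip_swap:
  assumes ab: "a \<in> {1..N}" "b \<in> {1..N}" and d: "a \<noteq> b"
  shows "has_order (heights N) (flip a \<circ> swap a b) 4"
proof (rule has_order_heightsI[where A = "{a, b}" and val = "\<lambda>f. (f a, f b)"
      and U = "\<lambda>(p, q). (- q, p)"])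
  fix p :: nat assume p: "0 < p" "p < 4"
  have "card {a, b} \<le> card {1..N}" using ab by (intro card_mono) auto
  then have "N \<ge> 2" using d by simp
  then obtain f where f: "f \<in> heights N" "f a = 1" "f b = 2"
    using heights_extend_pair[OF assms, of 1 2] by auto
  then show "\<exists>f\<in>heights N. ((\<lambda>(p, q). (- q, p)) ^^ p) (f a, f b) \<noteq> (f a, f b)"
    using less_numeral_cases(2)[OF p] by (auto simp: eval_nat_numeral intro!: bexI[of _ f])
qed (use d in \<open>auto simp: swap_def flip_def eval_nat_numeral\<close>)

text \<open>
  If \<open>p\<close> and \<open>q\<close> are nonzero integers, then \<open>(p, q)\<close> and \<open>(-p, q)\<close> are not both pairs of
  neighbours. On an orbit that contains neighbours the sign change and the odd exchange act as on
  a path with four vertices; on every other orbit only the sign change acts.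
\<close>

lemma order_flip_odd_swap:
  assumes ab: "a \<in> {1..N}" "b \<in> {1..N}" and d: "a \<noteq> b"
  shows "has_order (heights N) (flip a \<circ> odd_swap a b) 4"
proof -
  define U :: "int \<times> int \<Rightarrow> int \<times> int"
    where "U = (\<lambda>(p, q). if neighbours p q then (- q, p) else (- p, q))"
  have U: "U (p, q) = (if neighbours p q then (- q, p) else (- p, q))" for p q
    by (simp add: U_def)
  show ?thesis
  proof (rule has_order_heightsI[where A = "{a, b}" and val = "\<lambda>f. (f a, f b)" and U = U])
    show "(U ^^ 4) (f a, f b) = (f a, f b)" if f: "f \<in> heights N" for f
    proof -
      have "f a \<noteq> 0" "f b \<noteq> 0" using heights_nonzero[OF f] ab by auto
      then have "\<not> (neighbours (f a) (f b) \<and> neighbours (- f a) (f b))"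
        by (auto simp: neighbours_def)
      moreover have "neighbours (f b) (f a) = neighbours (f a) (f b)"
        "neighbours (- f b) (f a) = neighbours (- f a) (f b)"
        "neighbours (f b) (- f a) = neighbours (- f a) (f b)"
        by (auto simp: neighbours_def)
      ultimately show ?thesis
        by (cases "neighbours (f a) (f b)"; cases "neighbours (- f a) (f b)";
            simp add: U eval_nat_numeral neighbours_minus)
    qed
    fix p :: nat assume p: "0 < p" "p < 4"
    have "card {a, b} \<le> card {1..N}" using ab by (intro card_mono) auto
    then have "N \<ge> 2" using d by simp
    then obtain f where f: "f \<in> heights N" "f a = 1" "f b = 2"
      using heights_extend_pair[OF assms, of 1 2] by auto
    moreover have "(U ^^ p) (1, 2) \<noteq> (1, 2)"
      using less_numeral_cases(2)[OF p] by (auto simp: U eval_nat_numeral neighbours_def)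
    ultimately show "\<exists>f\<in>heights N. (U ^^ p) (f a, f b) \<noteq> (f a, f b)"
      by metis
  qed (use d in \<open>auto simp: U odd_swap_def swap_def flip_def\<close>)
qed

text \<open>
  The maps \<open>x \<circ> y\<close> and \<open>y \<circ> x\<close> are conjugate under the involution \<open>x\<close>.
\<close>

lemma has_order_commute:
  assumes x: "\<And>f. f \<in> S \<Longrightarrow> x f \<in> S" "\<And>f. x (x f) = f"
    and o: "has_order S (x \<circ> y) d"
  shows "has_order S (y \<circ> x) d"
proof -
  have conj: "x (((y \<circ> x) ^^ p) f) = ((x \<circ> y) ^^ p) (x f)" for p f
    by (induction p) auto
  have "(\<forall>f\<in>S. ((y \<circ> x) ^^ p) f = f) \<longleftrightarrow> (\<forall>f\<in>S. ((x \<circ> y) ^^ p) f = f)" for p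
    using x conj[of p] by metis
  then show ?thesis
    using o by (simp add: has_order_def)
qed

text \<open>
  The moves are numbered along the chain, and move \<open>k\<close> concerns the positions \<open>k\<close> and \<open>k + 1\<close>
  only. For the two ends this includes the positions 0 and \<open>m + n + 1\<close>, where all height functions
  vanish.
\<close>

definition gen :: "nat \<Rightarrow> nat \<Rightarrow> nat \<Rightarrow> (nat \<Rightarrow> int) \<Rightarrow> nat \<Rightarrow> int" where
  "gen m n k =
     (if k = 0 then flip 1 else if k = m + n then flip (m + n)
      else if k = m then odd_swap m (m + 1) else swap k (k + 1))"

lemma gen_heights:
  "f \<in> heights (m + n) \<Longrightarrow> k \<le> m + n \<Longrightarrow> m + n > 0 \<Longrightarrow> gen m n k f \<in> heights (m + n)"
  by (auto simp: gen_def intro!: flip_heights swap_heights odd_swap_heights)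

lemma gen_involution: "gen m n k (gen m n k f) = f"
  by (auto simp: gen_def flip_def swap_def odd_swap_def neighbours_commute fun_eq_iff)

lemma gen_local: "i \<notin> {k, k + 1} \<Longrightarrow> gen m n k f i = f i"
  by (auto simp: gen_def flip_def swap_def odd_swap_def)

lemma gen_cong:
  "f k = g k \<Longrightarrow> f (k + 1) = g (k + 1) \<Longrightarrow> i \<in> {k, k + 1} \<Longrightarrow> gen m n k f i = gen m n k g i"
  by (auto simp: gen_def flip_def swap_def odd_swap_def)

lemma gen_commute:
  assumes "j + 2 \<le> k"
  shows "gen m n j (gen m n k f) = gen m n k (gen m n j f)"
proof
  fix i
  consider "i \<in> {j, j + 1}" | "i \<in> {k, k + 1}" | "i \<notin> {j, j + 1}" "i \<notin> {k, k + 1}"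
    by blast
  then show "gen m n j (gen m n k f) i = gen m n k (gen m n j f) i"
  proof cases
    case 1
    then have "gen m n j (gen m n k f) i = gen m n j f i"
      using assms by (intro gen_cong gen_local) auto
    then show ?thesis using 1 assms gen_local[of i k] by auto
  next
    case 2
    then have "gen m n k (gen m n j f) i = gen m n k f i"
      using assms by (intro gen_cong gen_local) auto
    then show ?thesis using 2 assms gen_local[of i j] by auto
  qed (simp add: gen_local)
qed

text \<open>
  The increasing arrangement separates all moves: its consecutive values are neighbours, so the
  odd exchange acts on it as well.
\<close>

lemma gen_distinct:
  assumes "j < k" "k \<le> m + n" "m > 0" "n > 0"
  shows "\<exists>f\<in>heights (m + n). gen m n j f \<noteq> gen m n k f"
proof -
  define N where "N = m + n"
  define f where "f = (\<lambda>i. if i \<in> {1..N} then int i else 0)"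
  have "bij_betw int {1..N} {1..int N}"
    by (auto simp: bij_betw_def image_int_atLeastAtMost)
  then have "bij_betw (\<lambda>i. \<bar>f i\<bar>) {1..N} {1..int N}"
    by (rule iffD1[OF bij_betw_cong, rotated]) (auto simp: f_def)
  then have f: "f \<in> heights N"
    by (auto simp: heights_def f_def)
  have N: "N \<ge> 2" "j < N" using assms by (auto simp: N_def)
  have "gen m n j f \<noteq> gen m n k f"
  proof (cases "j = 0")
    case True
    then have "gen m n j f 1 = -1"
      using N by (simp add: gen_def flip_def f_def)
    moreover have "gen m n k f 1 \<noteq> -1"
      using N assms by (auto simp: gen_def flip_def swap_def odd_swap_def f_def N_def)
    ultimately show ?thesis by auto
  next
    case False
    then have "gen m n j f j = int j + 1"
      using N assms by (auto simp: gen_def swap_def odd_swap_def neighbours_def f_def N_def)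
    moreover have "gen m n k f j = int j"
      using N assms False by (subst gen_local) (auto simp: f_def)
    ultimately show ?thesis by auto
  qed
  then show ?thesis using f by (auto simp: N_def)
qed

lemma order_gen_far:
  assumes "j + 2 \<le> k" "k \<le> m + n" "m > 0" "n > 0"
  shows "has_order (heights (m + n)) (gen m n j \<circ> gen m n k) 2"
proof (rule has_orderI)
  fix p :: nat assume "0 < p" "p < 2"
  then have "p = Suc 0" by simp
  moreover obtain f where "f \<in> heights (m + n)" "gen m n j f \<noteq> gen m n k f"
    using gen_distinct[of j k m n] assms by auto
  ultimately show "\<exists>f\<in>heights (m + n). ((gen m n j \<circ> gen m n k) ^^ p) f \<noteq> f"
    using gen_involution[of m n] by (auto simp: comp_def intro!: bexI[of _ f]) metis
qed (use gen_commute[OF assms(1)] in \<open>simp_all add: eval_nat_numeral gen_involution\<close>)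

text \<open>
  The order of the product of the moves \<open>k\<close> and \<open>k + 1\<close>.
\<close>

definition label :: "nat \<Rightarrow> nat \<Rightarrow> nat \<Rightarrow> nat" where
  "label m n k = (if k = 0 \<or> k + 1 = m + n then 4 else if k = m \<or> k + 1 = m then 12 else 3)"

lemma order_gen_Suc:
  assumes k: "k < m + n" and pos: "m > 0" "n > 0"
  shows "has_order (heights (m + n)) (gen m n k \<circ> gen m n (k + 1)) (label m n k)"
proof -
  let ?S = "heights (m + n)"
  have rev: "has_order ?S (gen m n k \<circ> gen m n (k + 1)) d"
    if "has_order ?S (gen m n (k + 1) \<circ> gen m n k) d" for d
    using has_order_commute[OF _ gen_involution that] gen_heights k pos by auto
  consider "k = 0" | "k > 0" "k + 1 = m + n" | "k > 0" "k + 1 < m + n" "k = m"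
    | "k > 0" "k + 1 < m + n" "k + 1 = m" | "k > 0" "k + 1 < m + n" "k \<noteq> m" "k + 1 \<noteq> m"
    using k by linarith
  then show ?thesis
  proof cases
    case 1
    then show ?thesis
      using pos order_flip_swap[of 1 "m + n" 2] order_flip_odd_swap[of 1 "m + n" 2]
      by (auto simp: gen_def label_def numeral_2_eq_2)
  next
    case 2
    then show ?thesis
      using pos order_flip_swap[of "k + 1" "m + n" k] order_flip_odd_swap[of "k + 1" "m + n" k]
      by (intro rev) (auto simp: gen_def label_def swap_commute odd_swap_commute)
  next
    case 3
    then show ?thesis
      using order_swap_odd_swap[of "k + 2" "m + n" "k + 1" k]
      by (intro rev) (auto simp: gen_def label_def swap_commute odd_swap_commute)
  next
    case 4
    then show ?thesis
      using order_swap_odd_swap[of k "m + n" "k + 1" "k + 2"]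
      by (auto simp: gen_def label_def)
  next
    case 5
    then show ?thesis
      using order_swap_swap[of k "m + n" "k + 1" "k + 2"]
      by (auto simp: gen_def label_def)
  qed
qed

section \<open>Roots, heights and positive systems\<close>

text \<open>
  A field of characteristic 0 and the real line are vector spaces over the rationals, and the
  nonzero vector 1 is part of a basis.
\<close>

lemma exists_additive_to_real:
  "\<exists>\<phi>. additive (\<phi> :: 'k::field_char_0 \<Rightarrow> real) \<and> \<phi> 1 = 1"
proof -
  interpret vector_space_pair "\<lambda>q (x::'k). of_rat q * x" "\<lambda>q (x::real). of_rat q * x"
    by unfold_locales (simp_all add: algebra_simps of_rat_add of_rat_mult)
  have "vs1.independent {1}"
    by (rule vs1.independent_insertI) (simp_all add: vs1.independent_empty)
  then obtain \<phi> where "Vector_Spaces.linear (\<lambda>q (x::'k). of_rat q * x) (\<lambda>q (x::real). of_rat q * x) \<phi>" "\<phi> 1 = 1"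
    using linear_independent_extend[of "{1}" "\<lambda>_. 1"] by auto
  then show ?thesis
    by (auto simp: additive_def Vector_Spaces.linear_def module_hom_def module_hom_axioms_def)
qed

definition idx :: "nat \<Rightarrow> nat \<Rightarrow> nat + nat" where
  "idx m k = (if k \<le> m then Inl k else Inr (k - m))"

text \<open>
  The basis \<open>\<delta>\<^sub>1, \<dots>, \<delta>\<^sub>m, \<epsilon>\<^sub>1, \<dots>, \<epsilon>\<^sub>n\<close> with a single index from 1 to \<open>m + n\<close>. In this numbering
  even roots, odd roots and the members of the chain need fewer case distinctions.
\<close>

definition bas :: "nat \<Rightarrow> nat \<Rightarrow> 'k::field_char_0 weight" where
  "bas m k = (\<lambda>x. if x = idx m k then 1 else 0)"

lemma idx_eq: "idx m i = idx m j \<longleftrightarrow> i = j"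
  by (auto simp: idx_def)

lemma bas_delta: "k \<le> m \<Longrightarrow> bas m k = \<delta> k"
  by (simp add: bas_def idx_def \<delta>_def)

lemma bas_eps: "k > m \<Longrightarrow> bas m k = \<epsilon> (k - m)"
  by (simp add: bas_def idx_def \<epsilon>_def)

definition letters :: "nat \<Rightarrow> nat \<Rightarrow> 'k::field_char_0 weight set" where
  "letters m n = (\<Union>k\<in>{1..m + n}. pm (bas m k))"

lemma pm_uminus: "a \<in> pm v \<Longrightarrow> - a \<in> pm (v :: 'a::group_add)"
  by (auto simp: pm_def)

lemma letters_uminus: "a \<in> letters m n \<Longrightarrow> - a \<in> letters m n"
  by (auto simp: letters_def intro: pm_uminus)

lemma roots_sum:
  assumes "i \<in> {1..m + n}" "j \<in> {1..m + n}" "i \<noteq> j" "a \<in> pm (bas m i)" "b \<in> pm (bas m j)"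
  shows "a + b \<in> (roots m n :: 'k::field_char_0 weight set)"
proof -
  have *: "a + b \<in> (roots m n :: 'k weight set)"
    if "i < j" "i \<in> {1..m + n}" "j \<in> {1..m + n}" "a \<in> pm (bas m i)" "b \<in> pm (bas m j)" 
    for i j and a b :: "'k weight"
  proof -
    consider "j \<le> m" | "i \<le> m" "j > m" | "i > m" using that by linarith
    then show ?thesis
    proof cases
      case 1
      then have "\<exists>i\<in>{1..m}. \<exists>j\<in>{1..m}. i \<noteq> j \<and> a \<in> pm (\<delta> i) \<and> b \<in> pm (\<delta> j)"
        using that by (intro bexI[of _ i] bexI[of _ j]) (auto simp: bas_delta)
      then have "a + b \<in> even_roots m n" unfolding even_roots_def by blast
      then show ?thesis by (simp add: roots_def)
    next
      case 2
      then have "\<exists>i\<in>{1..m}. \<exists>j\<in>{1..n}. a \<in> pm (\<delta> i) \<and> b \<in> pm (\<epsilon> j)"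
        using that by (intro bexI[of _ i] bexI[of _ "j - m"]) (auto simp: bas_delta bas_eps)
      then have "a + b \<in> isotropic_odd_roots m n" unfolding isotropic_odd_roots_def by blast
      then show ?thesis by (simp add: roots_def)
    next
      case 3
      then have "\<exists>i\<in>{1..n}. \<exists>j\<in>{1..n}. i \<noteq> j \<and> a \<in> pm (\<epsilon> i) \<and> b \<in> pm (\<epsilon> j)"
        using that by (intro bexI[of _ "i - m"] bexI[of _ "j - m"]) (auto simp: bas_eps)
      then have "a + b \<in> even_roots m n" unfolding even_roots_def by blast
      then show ?thesis by (simp add: roots_def)
    qed
  qed
  show ?thesis
    using *[of i j a b] *[of j i b a] assms by (cases "i < j") (auto simp: add.commute)
qed

lemma roots_letter:
  assumes "a \<in> letters m n" shows "a \<in> (roots m n :: 'k::field_char_0 weight set)"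
proof -
  obtain k where k: "k \<in> {1..m + n}" "a \<in> pm (bas m k)"
    using assms by (auto simp: letters_def)
  show ?thesis
  proof (cases "k \<le> m")
    case True
    then show ?thesis using k by (auto simp: roots_def nonisotropic_odd_roots_def bas_delta)
  next
    case False
    then have "a \<in> (\<Union>j\<in>{1..n}. pm (\<epsilon> j))"
      using k by (intro UN_I[of "k - m"]) (auto simp: bas_eps)
    then show ?thesis by (auto simp: roots_def even_roots_def)
  qed
qed

lemma roots_double:
  assumes "i \<in> {1..m}" "a \<in> pm (bas m i)"
  shows "a + a \<in> (roots m n :: 'k::field_char_0 weight set)"
  using assms by (auto simp: roots_def even_roots_def bas_delta)

lemma roots_cases [consumes 1, case_names sum letter double]:
  fixes \<alpha> :: "'k::field_char_0 weight"
  assumes "\<alpha> \<in> roots m n"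
  obtains i j a b where "i \<in> {1..m + n}" "j \<in> {1..m + n}" "i \<noteq> j"
      "a \<in> pm (bas m i)" "b \<in> pm (bas m j)" "\<alpha> = a + b"
  | "\<alpha> \<in> letters m n"
  | a where "a \<in> letters m n" "\<alpha> = a + a"
proof -
  have d: "pm (\<delta> i) = (pm (bas m i) :: 'k weight set)" if "i \<in> {1..m}" for i
    using that by (simp add: bas_delta)
  have e: "pm (\<epsilon> j) = (pm (bas m (m + j)) :: 'k weight set)" if "j \<in> {1..n}" for j
    using that by (simp add: bas_eps)
  have dl: "a \<in> letters m n" if "i \<in> {1..m}" "a \<in> pm (\<delta> i)" for i and a :: "'k weight"
    using that by (auto simp: letters_def d intro!: bexI[of _ i])
  have el: "a \<in> letters m n" if "j \<in> {1..n}" "a \<in> pm (\<epsilon> j)" for j and a :: "'k weight"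
    using that by (auto simp: letters_def e intro!: bexI[of _ "m + j"])
  consider "\<alpha> \<in> even_roots m n" | "\<alpha> \<in> isotropic_odd_roots m n" | "\<alpha> \<in> nonisotropic_odd_roots m n"
    using assms by (auto simp: roots_def)
  then show thesis
  proof cases
    case 1
    then show thesis unfolding even_roots_def
    proof (elim UnE UN_E CollectE exE conjE bexE)
      fix a b i i' assume "i \<in> {1..m}" "i' \<in> {1..m}" "i \<noteq> i'" "a \<in> pm (\<delta> i)" "b \<in> pm (\<delta> i')" "\<alpha> = a + b"
      then show thesis using that(1)[of i i' a b] d by auto
    next
      fix a i assume "i \<in> {1..m}" "a \<in> pm (\<delta> i)" "\<alpha> = a + a"
      then show thesis using that(3)[of a] dl by blast
    next
      fix a b j j' assume "j \<in> {1..n}" "j' \<in> {1..n}" "j \<noteq> j'" "a \<in> pm (\<epsilon> j)" "b \<in> pm (\<epsilon> j')" "\<alpha> = a + b"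
      then show thesis using that(1)[of "m + j" "m + j'" a b] e by auto
    next
      fix j assume "j \<in> {1..n}" "\<alpha> \<in> pm (\<epsilon> j)"
      then show thesis using that(2) el by blast
    qed
  next
    case 2
    then obtain a b i j where "i \<in> {1..m}" "j \<in> {1..n}" "a \<in> pm (\<delta> i)" "b \<in> pm (\<epsilon> j)" "\<alpha> = a + b"
      unfolding isotropic_odd_roots_def by blast
    then show thesis using that(1)[of i "m + j" a b] d e by auto
  next
    case 3
    then obtain i where "i \<in> {1..m}" "\<alpha> \<in> pm (\<delta> i)"
      unfolding nonisotropic_odd_roots_def by blast
    then show thesis using that(2) dl by blast
  qed
qed

text \<open>
  Roots have integer coordinates, so any additive map that sends 1 to 1 serves the purpose.
\<close>

definition to_real :: "'k::field_char_0 \<Rightarrow> real" where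
  "to_real = (SOME \<phi>. additive \<phi> \<and> \<phi> 1 = 1)"

lemma to_real: "additive (to_real :: 'k::field_char_0 \<Rightarrow> real)" "to_real (1 :: 'k) = 1"
  using someI_ex[OF exists_additive_to_real[where ?'k = 'k]] by (simp_all add: to_real_def)

text \<open>
  The additive functional on weights with the values of \<open>f\<close> on the basis. It is real-valued
  because positive systems are defined by real functionals; on roots its values are integers.
\<close>

definition height :: "nat \<Rightarrow> nat \<Rightarrow> (nat \<Rightarrow> int) \<Rightarrow> 'k::field_char_0 weight \<Rightarrow> real" where
  "height m n f v = (\<Sum>k\<in>{1..m + n}. of_int (f k) * to_real (v (idx m k)))"

lemma additive_height: "additive (height m n f)"
  by (simp add: additive_def height_def additive.add[OF to_real(1)] distrib_left sum.distrib)

lemmas height_add = additive.add[OF additive_height]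
  and height_minus = additive.minus[OF additive_height]
  and height_diff = additive.diff[OF additive_height]
  and height_zero = additive.zero[OF additive_height]

lemma height_bas: "k \<in> {1..m + n} \<Longrightarrow> height m n f (bas m k :: 'k::field_char_0 weight) = of_int (f k)"
proof -
  assume k: "k \<in> {1..m + n}"
  have "to_real ((bas m k :: 'k weight) (idx m j)) = (if j = k then 1 else 0)" for j
    by (simp add: bas_def idx_eq to_real additive.zero[OF to_real(1)])
  then have "height m n f (bas m k :: 'k weight) = (\<Sum>j\<in>{1..m + n}. if j = k then of_int (f j) else 0)"
    unfolding height_def by (intro sum.cong) (simp_all del: of_int_eq_iff)
  then show ?thesis
    using k by simp
qed

lemma height_pm:
  assumes "k \<in> {1..m + n}" "a \<in> pm (bas m k)"
  shows "height m n f a = of_int (f k) \<and> a = bas m k \<or> height m n f a = of_int (- f k) \<and> a = - bas m k"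
  using assms by (auto simp: pm_def height_bas height_minus)

lemma height_letter:
  assumes f: "f \<in> heights (m + n)" and a: "a \<in> letters m n"
  obtains h where "height m n f a = of_int h" "h \<noteq> 0" "\<bar>h\<bar> \<le> int (m + n)"
proof -
  obtain k where k: "k \<in> {1..m + n}" "a \<in> pm (bas m k)"
    using a by (auto simp: letters_def)
  have "\<bar>f k\<bar> \<in> {1..int (m + n)}"
    using f k unfolding heights_def bij_betw_def by blast
  then show thesis
    using that[of "f k"] that[of "- f k"] height_pm[OF k, of f] by auto
qed

lemma height_letter_inj:
  fixes a b :: "'k::field_char_0 weight"
  assumes f: "f \<in> heights (m + n)" and a: "a \<in> letters m n" and b: "b \<in> letters m n"
    and eq: "height m n f a = height m n f b"
  shows "a = b"
proof -
  obtain k where k: "k \<in> {1..m + n}" "a \<in> pm (bas m k)" using a by (auto simp: letters_def)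
  obtain j where j: "j \<in> {1..m + n}" "b \<in> pm (bas m j)" using b by (auto simp: letters_def)
  have "\<bar>f k\<bar> = \<bar>f j\<bar>" "f k \<noteq> 0"
    using height_pm[OF k, of f] height_pm[OF j, of f] eq heights_nonzero[OF f k(1)] by auto
  then have "k = j" using heights_abs_eq[OF f] k j by blast
  then show ?thesis
    using height_pm[OF k, of f] height_pm[OF j, of f] eq \<open>f k \<noteq> 0\<close> by auto
qed

lemma letter_of_height:
  assumes f: "f \<in> heights (m + n)" and h: "h \<noteq> 0" "\<bar>h\<bar> \<le> int (m + n)"
  obtains a where "a \<in> letters m n" "height m n f a = of_int h"
proof -
  have "\<bar>h\<bar> \<in> (\<lambda>k. \<bar>f k\<bar>) ` {1..m + n}"
    using f h by (auto simp: heights_def bij_betw_def)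
  then obtain k where k: "k \<in> {1..m + n}" "\<bar>f k\<bar> = \<bar>h\<bar>" by auto
  have "bas m k \<in> letters m n" "- bas m k \<in> letters m n"
    using k by (auto simp: letters_def pm_def)
  moreover have "f k = h \<or> - f k = h" using k by auto
  ultimately show thesis
    using that[of "bas m k"] that[of "- bas m k"] height_bas[OF k(1), of f]
    by (auto simp: height_minus)
qed

text \<open>
  For a height function \<open>f\<close> this is the signed basis vector of height \<open>h\<close>. With the value 0 at
  \<open>h = 0\<close>, the single letter in the base becomes a difference of consecutive
  letters like all the others.
\<close>

definition letter_at :: "nat \<Rightarrow> nat \<Rightarrow> (nat \<Rightarrow> int) \<Rightarrow> nat \<Rightarrow> 'k::field_char_0 weight" where
  "letter_at m n f h =
     (if h = 0 then 0 else THE a. a \<in> letters m n \<and> height m n f a = of_nat h)"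

lemma letter_at_eqI:
  fixes a :: "'k::field_char_0 weight"
  assumes "f \<in> heights (m + n)" "a \<in> letters m n" "height m n f a = of_nat h"
  shows "letter_at m n f h = a"
proof -
  have "h \<noteq> 0" using height_letter[OF assms(1,2)] assms(3) by fastforce
  moreover have "(THE a. a \<in> letters m n \<and> height m n f a = of_nat h) = a"
  proof (rule the_equality)
    show "b = a" if "b \<in> letters m n \<and> height m n f b = of_nat h" for b
      using height_letter_inj[OF assms(1) _ assms(2), of b] assms(3) that by simp
  qed (use assms in simp)
  ultimately show ?thesis
    by (simp add: letter_at_def)
qed

lemma letter_at:
  assumes f: "f \<in> heights (m + n)" and h: "0 < h" "h \<le> m + n"
  shows "letter_at m n f h \<in> (letters m n :: 'k::field_char_0 weight set)"
    "height m n f (letter_at m n f h :: 'k weight) = of_nat h"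
proof -
  obtain a :: "'k weight" where a: "a \<in> letters m n" "height m n f a = of_int (int h)"
    using letter_of_height[OF f, of "int h"] h by auto
  then show "letter_at m n f h \<in> (letters m n :: 'k weight set)"
    "height m n f (letter_at m n f h :: 'k weight) = of_nat h"
    using letter_at_eqI[OF f a(1), of h] by simp_all
qed

lemma letter_at_0 [simp]: "letter_at m n f 0 = 0"
  by (simp add: letter_at_def)

lemma height_letter_at:
  assumes "f \<in> heights (m + n)" "h \<le> m + n"
  shows "height m n f (letter_at m n f h :: 'k::field_char_0 weight) = of_nat h"
  using letter_at(2)[OF assms(1)] assms(2) by (cases "h = 0") (auto simp: height_zero)

definition base :: "nat \<Rightarrow> nat \<Rightarrow> (nat \<Rightarrow> int) \<Rightarrow> 'k::field_char_0 weight set" where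
  "base m n f = (\<lambda>h. letter_at m n f (Suc h) - letter_at m n f h) ` {..<m + n}"

lemma letter_diff_root:
  assumes f: "f \<in> heights (m + n)" and a: "a \<in> (letters m n :: 'k::field_char_0 weight set)" and b: "b \<in> letters m n"
    and ne: "\<bar>height m n f a\<bar> \<noteq> \<bar>height m n f b\<bar>"
  shows "a + b \<in> roots m n" "a - b \<in> roots m n"
proof -
  obtain i where i: "i \<in> {1..m + n}" "a \<in> pm (bas m i)" using a by (auto simp: letters_def)
  obtain j where j: "j \<in> {1..m + n}" "b \<in> pm (bas m j)" using b by (auto simp: letters_def)
  have "i \<noteq> j" using ne height_pm[OF i, of f] height_pm[OF j, of f] by auto
  then show "a + b \<in> roots m n" "a - b \<in> roots m n"
    using roots_sum[OF i(1) j(1) _ i(2) j(2)] roots_sum[OF i(1) j(1) _ i(2) pm_uminus[OF j(2)]]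
    by auto
qed

text \<open>
  A root of height 1 that is a sum of two letters has one letter of some height \<open>h + 1 > 0\<close> and
  another of height \<open>-h < 0\<close>, hence is a difference of consecutive letters. A root \<open>2\<delta>\<^sub>i\<close> has even
  height.
\<close>

lemma base_eq_height_1:
  assumes f: "f \<in> heights (m + n)"
  shows "base m n f = {\<alpha> :: 'k::field_char_0 weight. \<alpha> \<in> roots m n \<and> height m n f \<alpha> = 1}" (is "_ = ?R")
proof (intro subset_antisym subsetI)
  fix \<alpha> :: "'k weight" assume "\<alpha> \<in> base m n f"
  then obtain h where h: "h < m + n" "\<alpha> = letter_at m n f (Suc h) - letter_at m n f h"
    by (auto simp: base_def)
  note at = letter_at[OF f, where ?'k = 'k]
  have "\<alpha> \<in> roots m n"
  proof (cases "h = 0")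
    case True
    then show ?thesis using h roots_letter[OF at(1)[of "Suc h"]] by (simp add: Suc_le_eq)
  next
    case False
    then show ?thesis
      using h at(2)[of h] at(2)[of "Suc h"] letter_diff_root(2)[OF f at(1)[of "Suc h"] at(1)[of h]]
      by simp
  qed
  then show "\<alpha> \<in> ?R"
    using h by (simp add: height_diff height_letter_at[OF f])
next
  fix \<alpha> :: "'k weight" assume "\<alpha> \<in> ?R"
  then have r: "\<alpha> \<in> roots m n" and ht: "height m n f \<alpha> = 1" by auto
  have pair: "a + b \<in> base m n f"
    if ab: "a \<in> letters m n" "b \<in> letters m n" and s: "height m n f a + height m n f b = 1"
      and pos: "height m n f a > 0" for a b :: "'k weight"
  proof -
    obtain p where p: "height m n f a = of_int p" "p \<noteq> 0" "\<bar>p\<bar> \<le> int (m + n)" 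
      using height_letter[OF f ab(1)] .
    obtain q where q: "height m n f b = of_int q" "q \<noteq> 0" "\<bar>q\<bar> \<le> int (m + n)" 
      using height_letter[OF f ab(2)] .
    have pq: "p + q = 1" "p > 0" using p q s pos by linarith+
    define h where "h = nat (- q)"
    have h: "h < m + n" "height m n f (- b) = of_nat h" "height m n f a = of_nat (Suc h)"
      using p q pq by (auto simp: h_def height_minus)
    have "a + b = letter_at m n f (Suc h) - letter_at m n f h"
      using letter_at_eqI[OF f ab(1) h(3)] letter_at_eqI[OF f letters_uminus[OF ab(2)] h(2)] by simp
    then show ?thesis
      using h(1) unfolding base_def by (intro image_eqI[of _ _ h]) simp_all
  qed
  from r show "\<alpha> \<in> base m n f"
  proof (cases rule: roots_cases)
    case (sum i j a b)
    have ab: "a \<in> letters m n" "b \<in> letters m n" using sum by (auto simp: letters_def)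
    have s: "height m n f a + height m n f b = 1" using ht sum by (simp add: height_add)
    show ?thesis
      using pair[of a b] pair[of b a] ab s sum(6) by (cases "height m n f a > 0") (auto simp: add.commute)
  next
    case letter
    then have "\<alpha> = letter_at m n f (Suc 0) - letter_at m n f 0"
      using letter_at_eqI[OF f letter, of 1] ht by simp
    moreover have "0 < m + n" using letter by (auto simp: letters_def)
    ultimately show ?thesis
      unfolding base_def by (intro image_eqI[of _ _ 0]) simp_all
  next
    case (double a)
    then have "2 * height m n f a = 1" using ht height_add[of m n f a a] by simp
    moreover obtain h where "height m n f a = of_int h" using height_letter[OF f double(1)] .
    ultimately have "2 * h = 1" by linarith
    then have False by presburger
    then show ?thesis ..
  qed
qed

lemma height_int:
  fixes \<alpha> :: "'k::field_char_0 weight"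
  assumes f: "f \<in> heights (m + n)" and r: "\<alpha> \<in> roots m n"
  obtains h where "height m n f \<alpha> = of_int h" "h \<noteq> 0"
  using r
proof (cases rule: roots_cases)
  case (sum i j a b)
  have "\<bar>f i\<bar> \<noteq> \<bar>f j\<bar>" using heights_abs_eq[OF f] sum by auto
  then show thesis
    using that[of "f i + f j"] that[of "f i - f j"] that[of "- f i + f j"] that[of "- f i - f j"]
      height_pm[OF sum(1,4), of f] height_pm[OF sum(2,5), of f] sum(6)
    by (auto simp: height_add)
next
  case letter
  then show thesis using height_letter[OF f letter] that by metis
next
  case (double a)
  obtain h where "height m n f a = of_int h" "h \<noteq> 0" using height_letter[OF f double(1)] .
  then show thesis using that[of "h + h"] double(2) height_add[of m n f a a] by simp
qed

text \<open>
  Positive roots have height at least 1, so those of height 1 are indecomposable. A root of larger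
  height is decomposable: its letter of largest height \<open>p\<close> can be reached in two steps, through
  the letter of height \<open>p - 1\<close>, unless both letters are positive roots already.
\<close>

lemma simple_roots_positive:
  assumes f: "f \<in> heights (m + n)"
  shows "simple_roots {\<alpha> \<in> roots m n. height m n f \<alpha> > 0} = (base m n f :: 'k::field_char_0 weight set)"
proof -
  let ?P = "{\<alpha> \<in> roots m n. height m n f \<alpha> > 0} :: 'k weight set"
  have ge1: "height m n f \<alpha> \<ge> 1" if "\<alpha> \<in> ?P" for \<alpha>
  proof -
    from that have "\<alpha> \<in> roots m n" by simp
    then obtain h where "height m n f \<alpha> = of_int h" by (rule height_int[OF f])
    then show ?thesis using that by simp
  qed
  have indec: "\<not> (\<exists>\<beta>\<in>?P. \<exists>\<gamma>\<in>?P. \<alpha> = \<beta> + \<gamma>)" if "height m n f \<alpha> = 1" for \<alpha>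
  proof
    assume "\<exists>\<beta>\<in>?P. \<exists>\<gamma>\<in>?P. \<alpha> = \<beta> + \<gamma>"
    then obtain \<beta> \<gamma> where "\<beta> \<in> ?P" "\<gamma> \<in> ?P" "\<alpha> = \<beta> + \<gamma>" by blast
    then show False using ge1[of \<beta>] ge1[of \<gamma>] that by (simp add: height_add)
  qed
  have dec: "\<exists>\<beta>\<in>?P. \<exists>\<gamma>\<in>?P. \<alpha> = \<beta> + \<gamma>" if P: "\<alpha> \<in> ?P" and ne: "height m n f \<alpha> \<noteq> 1" for \<alpha>
  proof -
    have ge2: "height m n f \<alpha> \<ge> 2"
    proof -
      from P have "\<alpha> \<in> roots m n" by simp
      then obtain h where "height m n f \<alpha> = of_int h" by (rule height_int[OF f])
      then show ?thesis using P ne by simp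
    qed
    have split: "\<exists>\<beta>\<in>?P. \<exists>\<gamma>\<in>?P. a + b = \<beta> + \<gamma>"
      if ab: "a \<in> letters m n" "b \<in> letters m n" and s: "height m n f (a + b) \<ge> 2"
        and pos: "height m n f a > 0" for a b :: "'k weight"
    proof (cases "height m n f b > 0")
      case True
      then show ?thesis using ab pos roots_letter by (intro bexI[of _ a] bexI[of _ b]) auto
    next
      case False
      obtain p where p: "height m n f a = of_int p" "p \<noteq> 0" "\<bar>p\<bar> \<le> int (m + n)" 
        using height_letter[OF f ab(1)] .
      obtain q where q: "height m n f b = of_int q" "q \<noteq> 0" "\<bar>q\<bar> \<le> int (m + n)" 
        using height_letter[OF f ab(2)] .
      have pq: "p + q \<ge> 2" "q < 0" using s p q False by (auto simp: height_add)
      then obtain c :: "'k weight" where c: "c \<in> letters m n" "height m n f c = of_int (p - 1)"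
        using letter_of_height[OF f, of "p - 1"] p q by auto
      \<comment> \<open>As \<open>p + q \<ge> 2\<close>, the height of \<open>c\<close> still exceeds that of \<open>-b\<close>, so \<open>c + b\<close> is a positive root.\<close>
      have "a - c \<in> roots m n" "c + b \<in> roots m n"
        using pq p q c letter_diff_root[OF f ab(1) c(1)] letter_diff_root[OF f c(1) ab(2)] by auto
      moreover have "height m n f (a - c) > 0" "height m n f (c + b) > 0"
        using pq p q c by (simp_all add: height_add height_diff)
      ultimately show ?thesis
        by (intro bexI[of _ "a - c"] bexI[of _ "c + b"]) (auto simp: algebra_simps)
    qed
    have "\<alpha> \<in> roots m n" using P by simp
    then show ?thesis
    proof (cases rule: roots_cases)
      case (sum i j a b)
      have ab: "a \<in> letters m n" "b \<in> letters m n" using sum by (auto simp: letters_def)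
      show ?thesis
      proof (cases "height m n f a > 0")
        case True
        then show ?thesis using split[OF ab] ge2 sum(6) by simp
      next
        case False
        then have "height m n f b > 0" using ge2 sum(6) by (simp add: height_add)
        then show ?thesis using split[OF ab(2,1)] ge2 sum(6) by (simp add: add.commute)
      qed
    next
      case letter
      obtain p where p: "height m n f \<alpha> = of_int p" "p \<noteq> 0" "\<bar>p\<bar> \<le> int (m + n)" 
        using height_letter[OF f letter] .
      then obtain c :: "'k weight" where c: "c \<in> letters m n" "height m n f c = of_int (p - 1)"
        using letter_of_height[OF f, of "p - 1"] ge2 by auto
      then have "\<alpha> - c \<in> roots m n"
        using p ge2 letter_diff_root[OF f letter c(1)] by auto
      then show ?thesis
        using p c ge2 roots_letter[OF c(1)]
        by (intro bexI[of _ "\<alpha> - c"] bexI[of _ c]) (auto simp: height_diff)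
    next
      case (double a)
      then show ?thesis using split[of a a] ge2 height_add[of m n f a a] by auto
    qed
  qed
  have "simple_roots ?P = {\<alpha> \<in> ?P. height m n f \<alpha> = 1}"
    unfolding simple_roots_def using indec dec by blast
  also have "\<dots> = base m n f"
    unfolding base_eq_height_1[OF f] by (rule Collect_cong) auto
  finally show ?thesis .
qed

section \<open>Borel subalgebras are signed arrangements\<close>

text \<open>
  The base determines the letters one after the other, starting with \<open>l\<^sub>0 = 0\<close>: the letter
  \<open>l\<^sub>h\<^sub>+\<^sub>1\<close> differs from \<open>l\<^sub>h\<close> by an element of the base.
\<close>

lemma base_inj:
  assumes f: "f \<in> heights (m + n)" and g: "g \<in> heights (m + n)"
    and eq: "base m n f = (base m n g :: 'k::field_char_0 weight set)"
  shows "f = g"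
proof
  note at = letter_at[OF f, where ?'k = 'k]
  have same: "h \<le> m + n \<Longrightarrow> letter_at m n f h = (letter_at m n g h :: 'k weight)" for h
  proof (induction h)
    case (Suc h)
    have "letter_at m n f (Suc h) - letter_at m n f h \<in> (base m n g :: 'k weight set)"
      using Suc.prems eq[symmetric] by (auto simp: base_def)
    then have "height m n g (letter_at m n f (Suc h) :: 'k weight) = 1 + height m n g (letter_at m n f h :: 'k weight)"
      by (simp add: base_eq_height_1[OF g] height_diff)
    also have "\<dots> = of_nat (Suc h)"
      using Suc height_letter_at[OF g, of h, where ?'k = 'k] by simp
    finally show ?case
      using letter_at_eqI[OF g at(1)[of "Suc h"]] Suc.prems by simp
  qed simp
  fix k
  show "f k = g k"
  proof (cases "k \<in> {1..m + n}")
    case True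
    have mem: "(bas m k :: 'k weight) \<in> letters m n" "- (bas m k :: 'k weight) \<in> letters m n"
      using True by (auto simp: letters_def pm_def)
    define h where "h = nat \<bar>f k\<bar>"
    have "\<bar>f k\<bar> \<in> {1..int (m + n)}"
      using f True unfolding heights_def bij_betw_def by blast
    then have h: "h \<le> m + n" "f k = int h \<or> - f k = int h" by (auto simp: h_def)
    then obtain a :: "'k weight" where a: "a = bas m k \<and> f k = int h \<or> a = - bas m k \<and> - f k = int h"
      by blast
    then have "a \<in> letters m n" "height m n f a = of_nat h"
      using mem by (auto simp: height_bas[OF True] height_minus)
    then have "letter_at m n f h = a" by (rule letter_at_eqI[OF f])
    then have "height m n g a = of_nat h"
      using same[OF h(1)] height_letter_at[OF g h(1), where ?'k = 'k] by simp
    then show ?thesis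
      using a by (auto simp: height_bas[OF True] height_minus)
  qed (simp add: heights_outside[OF f] heights_outside[OF g])
qed

lemma add_pos_iff_larger_pos:
  fixes p q :: real
  assumes "\<bar>p\<bar> \<noteq> \<bar>q\<bar>"
  shows "p + q > 0 \<longleftrightarrow> (if \<bar>p\<bar> < \<bar>q\<bar> then q > 0 else p > 0)"
  using assms by (auto simp: abs_if split: if_splits)

text \<open>
  Regularity on the roots says that the absolute values of \<open>\<phi>\<close> on the basis are nonzero and
  distinct. Replacing each of them by its rank preserves signs and comparisons, and these decide
  the sign of \<open>\<phi>\<close> on every root.
\<close>

lemma heights_of_functional:
  fixes \<phi> :: "'k::field_char_0 weight \<Rightarrow> real"
  assumes add: "additive \<phi>" and reg: "\<forall>\<alpha>\<in>roots m n. \<phi> \<alpha> \<noteq> 0"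
  obtains f where "f \<in> heights (m + n)"
    "\<And>\<alpha>. \<alpha> \<in> roots m n \<Longrightarrow> height m n f \<alpha> > 0 \<longleftrightarrow> \<phi> \<alpha> > 0"
proof -
  define N where "N = m + n"
  define g where "g k = \<phi> (bas m k)" for k
  \<comment> \<open>The rank of the \<open>k\<close>-th basis vector among all, by absolute value.\<close>
  define r where "r k = card {j \<in> {1..N}. \<bar>g j\<bar> \<le> \<bar>g k\<bar>}" for k
  define f where "f k = (if k \<in> {1..N} then if g k > 0 then int (r k) else - int (r k) else 0)" for k
  have mem: "(bas m k :: 'k weight) \<in> letters m n" if "k \<in> {1..N}" for k
    using that by (auto simp: letters_def pm_def N_def)
  have g_ne: "\<bar>g i\<bar> \<noteq> \<bar>g j\<bar>" if "i \<in> {1..N}" "j \<in> {1..N}" "i \<noteq> j" for i j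
  proof -
    have "bas m i + bas m j \<in> (roots m n :: 'k weight set)" "bas m i + - bas m j \<in> (roots m n :: 'k weight set)"
      using that by (auto simp: N_def pm_def intro!: roots_sum[of i _ _ j] simp del: add_uminus_conv_diff)
    then have "\<phi> (bas m i + bas m j) \<noteq> 0" "\<phi> (bas m i + - bas m j) \<noteq> 0" using reg by blast+
    then show ?thesis
      by (auto simp: additive.add[OF add] additive.diff[OF add] g_def abs_eq_iff)
  qed
  have r_mono: "r i < r j" if "\<bar>g i\<bar> < \<bar>g j\<bar>" "j \<in> {1..N}" for i j
  proof -
    have "{k \<in> {1..N}. \<bar>g k\<bar> \<le> \<bar>g i\<bar>} \<subseteq> {k \<in> {1..N}. \<bar>g k\<bar> \<le> \<bar>g j\<bar>}"
      using that by auto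
    moreover have "j \<in> {k \<in> {1..N}. \<bar>g k\<bar> \<le> \<bar>g j\<bar>}" "j \<notin> {k \<in> {1..N}. \<bar>g k\<bar> \<le> \<bar>g i\<bar>}"
      using that by auto
    ultimately show ?thesis
      unfolding r_def by (intro psubset_card_mono psubsetI) (simp, simp, metis)
  qed
  have r_less: "r i < r j \<longleftrightarrow> \<bar>g i\<bar> < \<bar>g j\<bar>" if "i \<in> {1..N}" "j \<in> {1..N}" for i j
  proof (cases "i = j")
    case False
    from g_ne[OF that this] consider "\<bar>g i\<bar> < \<bar>g j\<bar>" | "\<bar>g j\<bar> < \<bar>g i\<bar>" by linarith
    then show ?thesis using r_mono[of i j] r_mono[of j i] that by cases auto
  qed simp
  have r_inj: "inj_on r {1..N}"
    using r_less g_ne unfolding inj_on_def by (metis less_irrefl linorder_neqE)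
  have r_range: "r ` {1..N} \<subseteq> {1..N}"
  proof
    fix x assume "x \<in> r ` {1..N}"
    then obtain k where k: "k \<in> {1..N}" "x = r k" by blast
    have "card {j \<in> {1..N}. \<bar>g j\<bar> \<le> \<bar>g k\<bar>} \<le> card {1..N}" by (intro card_mono) auto
    moreover have "card {j \<in> {1..N}. \<bar>g j\<bar> \<le> \<bar>g k\<bar>} > 0" using k by (subst card_gt_0_iff) auto
    ultimately show "x \<in> {1..N}" using k by (simp add: r_def)
  qed
  have "bij_betw r {1..N} {1..N}"
    using endo_inj_surj[OF _ r_range r_inj] r_inj by (simp add: bij_betw_def)
  moreover have "bij_betw int {1..N} {1..int N}"
    by (auto simp: bij_betw_def image_int_atLeastAtMost)
  ultimately have "bij_betw (int \<circ> r) {1..N} {1..int N}" by (rule bij_betw_trans)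
  then have "bij_betw (\<lambda>k. \<bar>f k\<bar>) {1..N} {1..int N}"
    by (rule iffD1[OF bij_betw_cong, rotated]) (auto simp: f_def)
  then have f: "f \<in> heights N" by (auto simp: heights_def f_def)
  have f': "f \<in> heights (m + n)" using f by (simp add: N_def)
  have abs_f: "\<bar>f i\<bar> < \<bar>f j\<bar> \<longleftrightarrow> \<bar>g i\<bar> < \<bar>g j\<bar>" if "i \<in> {1..N}" "j \<in> {1..N}" for i j
    using r_less[OF that] that by (auto simp: f_def)
  have sgn_f: "f k > 0 \<longleftrightarrow> g k > 0" "f k \<noteq> 0" "g k \<noteq> 0" if k: "k \<in> {1..N}" for k
  proof -
    show "f k \<noteq> 0" using heights_nonzero[OF f k] .
    then show "f k > 0 \<longleftrightarrow> g k > 0" using k by (auto simp: f_def)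
    show "g k \<noteq> 0" using reg roots_letter[OF mem[OF k]] by (auto simp: g_def)
  qed
  have val: "\<phi> a = g k \<and> height m n f a = of_int (f k) \<or> \<phi> a = - g k \<and> height m n f a = - of_int (f k)"
    if "k \<in> {1..N}" "a \<in> pm (bas m k)" for k and a :: "'k weight"
    using that by (auto simp: pm_def g_def additive.minus[OF add] height_minus height_bas N_def)
  have letter_sign: "height m n f a > 0 \<longleftrightarrow> \<phi> a > 0" if "a \<in> letters m n" for a :: "'k weight"
  proof -
    from that obtain k where k: "k \<in> {1..N}" "a \<in> pm (bas m k)" by (auto simp: letters_def N_def)
    show ?thesis using val[OF k] sgn_f[OF k(1)] by auto
  qed
  have "height m n f \<alpha> > 0 \<longleftrightarrow> \<phi> \<alpha> > 0" if "\<alpha> \<in> roots m n" for \<alpha>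
    using that
  proof (cases rule: roots_cases)
    case (sum i j a b)
    have ij: "i \<in> {1..N}" "j \<in> {1..N}" using sum by (auto simp: N_def)
    have real_f: "\<bar>f i\<bar> < \<bar>f j\<bar> \<longleftrightarrow> \<bar>real_of_int (f i)\<bar> < \<bar>real_of_int (f j)\<bar>" "\<bar>real_of_int (f i)\<bar> \<noteq> \<bar>real_of_int (f j)\<bar>"
      using heights_abs_eq[OF f ij] sum(3) by linarith+
    have "a \<in> letters m n" "b \<in> letters m n" using sum by (auto simp: letters_def)
    note s = letter_sign[OF this(1)] letter_sign[OF this(2)]
    have abs: "\<bar>height m n f a\<bar> = \<bar>real_of_int (f i)\<bar>" "\<bar>height m n f b\<bar> = \<bar>real_of_int (f j)\<bar>"
       "\<bar>\<phi> a\<bar> = \<bar>g i\<bar>" "\<bar>\<phi> b\<bar> = \<bar>g j\<bar>"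
      using val[OF ij(1) sum(4)] val[OF ij(2) sum(5)] by auto
    have cmp: "\<bar>height m n f a\<bar> < \<bar>height m n f b\<bar> \<longleftrightarrow> \<bar>\<phi> a\<bar> < \<bar>\<phi> b\<bar>"
      "\<bar>height m n f a\<bar> \<noteq> \<bar>height m n f b\<bar>" "\<bar>\<phi> a\<bar> \<noteq> \<bar>\<phi> b\<bar>"
      unfolding abs using real_f abs_f[OF ij] g_ne[OF ij] sum(3) by auto
    have "height m n f a + height m n f b > 0 \<longleftrightarrow> \<phi> a + \<phi> b > 0"
      using cmp s by (simp add: add_pos_iff_larger_pos)
    then show ?thesis by (simp add: sum(6) height_add additive.add[OF add])
  next
    case letter
    then show ?thesis by (rule letter_sign)
  next
    case (double a)
    then show ?thesis
      using letter_sign[OF double(1)] height_add[of m n f a a] additive.add[OF add, of a a] by auto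
  qed
  then show thesis using that f' by blast
qed

lemma borels_eq: "borels m n = (base m n :: _ \<Rightarrow> 'k::field_char_0 weight set) ` heights (m + n)"
proof (intro subset_antisym subsetI)
  fix B :: "'k weight set" assume "B \<in> borels m n"
  then obtain \<phi> :: "'k weight \<Rightarrow> real" where \<phi>: "additive \<phi>" "\<forall>\<alpha>\<in>roots m n. \<phi> \<alpha> \<noteq> 0"
    and B: "B = simple_roots {\<alpha> \<in> roots m n. \<phi> \<alpha> > 0}"
    by (auto simp: borels_def positive_systems_def)
  obtain f where f: "f \<in> heights (m + n)" "\<And>\<alpha>. \<alpha> \<in> roots m n \<Longrightarrow> height m n f \<alpha> > 0 \<longleftrightarrow> \<phi> \<alpha> > 0"
    using heights_of_functional[OF \<phi>] by blast
  have "{\<alpha> \<in> roots m n. \<phi> \<alpha> > 0} = {\<alpha> \<in> roots m n. height m n f \<alpha> > 0}"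
    using f(2) by blast
  then have "B = base m n f" using B simple_roots_positive[OF f(1), where ?'k = 'k] by simp
  then show "B \<in> base m n ` heights (m + n)" using f(1) by blast
next
  fix B :: "'k weight set" assume "B \<in> base m n ` heights (m + n)"
  then obtain f where f: "f \<in> heights (m + n)" "B = base m n f" by blast
  have "height m n f \<alpha> \<noteq> 0" if "\<alpha> \<in> roots m n" for \<alpha> :: "'k weight"
    using height_int[OF f(1) that] by (metis of_int_eq_0_iff)
  then have "{\<alpha> \<in> roots m n. height m n f \<alpha> > 0} \<in> (positive_systems m n :: 'k weight set set)"
    unfolding positive_systems_def using additive_height by blast
  then show "B \<in> borels m n"
    using f simple_roots_positive[OF f(1), where ?'k = 'k] unfolding borels_def by blast
qed

section \<open>The invariant form and reflections of bases\<close>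

definition bas_norm :: "nat \<Rightarrow> nat \<Rightarrow> 'k::field_char_0" where
  "bas_norm m k = (if k \<le> m then 1 else -1)"

lemma form_bas:
  assumes "k \<in> {1..m + n}"
  shows "form m n v (bas m k) = bas_norm m k * v (idx m k)"
proof (cases "k \<le> m")
  case True
  then have "form m n v (bas m k) = (\<Sum>i=1..m. if i = k then v (Inl i) else 0) - (\<Sum>j=1..n. 0)"
    unfolding form_def by (intro arg_cong2[where f = "(-)"] sum.cong) (auto simp: bas_def idx_def)
  then show ?thesis using True assms by (simp add: bas_norm_def idx_def)
next
  case False
  then have "form m n v (bas m k) = (\<Sum>i=1..m. 0) - (\<Sum>j=1..n. if j = k - m then v (Inr j) else 0)"
    unfolding form_def by (intro arg_cong2[where f = "(-)"] sum.cong) (auto simp: bas_def idx_def)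
  then show ?thesis using False assms by (simp add: bas_norm_def idx_def, presburger)
qed

lemma form_commute: "form m n v w = form m n w v"
  by (simp add: form_def mult.commute)

lemma form_linear:
  "form m n (u + v) w = form m n u w + form m n v w"
  "form m n (u - v) w = form m n u w - form m n v w"
  "form m n (- v) w = - form m n v w"
  "form m n 0 w = 0"
  "form m n w (u + v) = form m n w u + form m n w v"
  "form m n w (u - v) = form m n w u - form m n w v"
  "form m n w (- v) = - form m n w v"
  "form m n w 0 = 0"
  by (simp_all add: form_def algebra_simps sum.distrib sum_subtractf sum_negf)

lemma form_bas_bas:
  "i \<in> {1..m + n} \<Longrightarrow> j \<in> {1..m + n} \<Longrightarrow>
    form m n (bas m i) (bas m j) = (if i = j then bas_norm m i else 0)"
  by (simp add: form_bas) (simp add: bas_def idx_eq)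

lemma form_pm:
  assumes "i \<in> {1..m + n}" "j \<in> {1..m + n}" "a \<in> pm (bas m i)" "b \<in> pm (bas m j)"
  shows "i \<noteq> j \<Longrightarrow> form m n a b = 0" "form m n a a = bas_norm m i"
  using assms by (auto simp: pm_def form_linear form_bas_bas)

lemma form_letter_at:
  assumes f: "f \<in> heights (m + n)" and h: "h \<le> m + n" "h' \<le> m + n" "h \<noteq> h'"
  shows "form m n (letter_at m n f h) (letter_at m n f h' :: 'k::field_char_0 weight) = 0"
proof (cases "h = 0 \<or> h' = 0")
  case False
  note at = letter_at[OF f, where ?'k = 'k]
  obtain i where i: "i \<in> {1..m + n}" "(letter_at m n f h :: 'k weight) \<in> pm (bas m i)"
    using at(1)[of h] h False by (auto simp: letters_def)
  obtain j where j: "j \<in> {1..m + n}" "(letter_at m n f h' :: 'k weight) \<in> pm (bas m j)"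
    using at(1)[of h'] h False by (auto simp: letters_def)
  have "i \<noteq> j"
    using height_pm[OF i, of f] height_pm[OF j, of f] at(2)[of h] at(2)[of h'] h False by auto
  then show ?thesis using form_pm(1)[OF i(1) j(1) i(2) j(2)] by simp
qed (auto simp: form_linear)

lemma form_letter_at_self:
  assumes f: "f \<in> heights (m + n)" and h: "0 < h" "h \<le> m + n"
  shows "form m n (letter_at m n f h) (letter_at m n f h :: 'k::field_char_0 weight) \<noteq> 0"
proof -
  obtain i where i: "i \<in> {1..m + n}" "(letter_at m n f h :: 'k weight) \<in> pm (bas m i)"
    using letter_at(1)[OF f h, where ?'k = 'k] by (auto simp: letters_def)
  then show ?thesis using form_pm(2)[OF i(1) i(1) i(2) i(2)] by (simp add: bas_norm_def)
qed

lemma Collect_image_eq: "{x \<in> f ` A. P x} = f ` {j \<in> A. P (f j)}"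
  by blast

lemma translated_image: "{g x |x. x \<in> f ` A \<and> P x} = (\<lambda>j. g (f j)) ` {j \<in> A. P (f j)}"
  by blast

text \<open>
  The simple root \<open>\<gamma> = l\<^sub>h\<^sub>+\<^sub>1 - l\<^sub>h\<close> is isotropic, and the only simple roots not orthogonal to it are
  its neighbours \<open>l\<^sub>h - l\<^sub>h\<^sub>-\<^sub>1\<close> and, if \<open>h + 1 < N\<close>, \<open>l\<^sub>h\<^sub>+\<^sub>2 - l\<^sub>h\<^sub>+\<^sub>1\<close>. Adding \<open>\<gamma>\<close> to them gives \<open>l\<^sub>h\<^sub>+\<^sub>1 - l\<^sub>h\<^sub>-\<^sub>1\<close> and
  \<open>l\<^sub>h\<^sub>+\<^sub>2 - l\<^sub>h\<close>, so the odd reflection exchanges \<open>l\<^sub>h\<close> and \<open>l\<^sub>h\<^sub>+\<^sub>1\<close> in the sequence.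
\<close>

lemma odd_move_chain:
  fixes l :: "nat \<Rightarrow> 'k::field_char_0 weight"
  assumes orth: "\<And>i j. i \<le> N \<Longrightarrow> j \<le> N \<Longrightarrow> i \<noteq> j \<Longrightarrow> form m n (l i) (l j) = 0"
    and nz: "\<And>i. 0 < i \<Longrightarrow> i \<le> N \<Longrightarrow> form m n (l i) (l i) \<noteq> 0"
    and h: "0 < h" "h < N"
    and iso: "form m n (l (Suc h)) (l (Suc h)) = - form m n (l h) (l h)"
  shows "odd_move m n (l (Suc h) - l h) ((\<lambda>j. l (Suc j) - l j) ` {..<N}) =
    (\<lambda>j. (l \<circ> transpose h (Suc h)) (Suc j) - (l \<circ> transpose h (Suc h)) j) ` {..<N}"
    (is "odd_move m n ?\<gamma> (?\<alpha> ` _) = ?\<beta> ` _")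
proof -
  have form_\<alpha>: "form m n (?\<alpha> j) ?\<gamma> =
      (if Suc j = h then - form m n (l h) (l h) else if j = Suc h then form m n (l h) (l h) else 0)"
    if "j < N" for j
  proof -
    consider "j = h" | "Suc j = h" | "j = Suc h" | "j \<noteq> h" "Suc j \<noteq> h" "j \<noteq> Suc h" by blast
    then show ?thesis
      by cases (use that h iso in \<open>auto simp: form_linear orth\<close>)
  qed
  \<comment> \<open>Pairing with \<open>l\<^sub>h\<close> separates \<open>\<gamma>\<close> from the simple roots orthogonal to it.\<close>
  have ne: "?\<alpha> j \<noteq> ?\<gamma>" if "j < N" "j \<noteq> h" "Suc j \<noteq> h" for j
  proof
    assume "?\<alpha> j = ?\<gamma>"
    then have "form m n (?\<alpha> j) (l h) = form m n ?\<gamma> (l h)" by simp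
    then show False using that h orth nz[of h] by (simp add: form_linear)
  qed
  have neighbour: "form m n (?\<alpha> j) ?\<gamma> \<noteq> 0 \<longleftrightarrow> Suc j = h \<or> j = Suc h" if "j < N" for j
    using form_\<alpha>[OF that] nz[of h] h by auto
  have kept: "form m n (?\<alpha> j) ?\<gamma> = 0 \<and> ?\<alpha> j \<noteq> ?\<gamma> \<longleftrightarrow> j \<noteq> h \<and> \<not> (Suc j = h \<or> j = Suc h)"
    if "j < N" for j
  proof (cases "j = h")
    case False
    then show ?thesis using neighbour[OF that] ne[OF that] by blast
  qed simp
  have \<beta>: "?\<beta> j = (if j = h then - ?\<gamma> else if Suc j = h \<or> j = Suc h then ?\<alpha> j + ?\<gamma> else ?\<alpha> j)" for j
    by (auto simp: transpose_def)
  have "odd_move m n ?\<gamma> (?\<alpha> ` {..<N}) = {- ?\<gamma>}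
      \<union> ?\<alpha> ` {j. j < N \<and> j \<noteq> h \<and> \<not> (Suc j = h \<or> j = Suc h)}
      \<union> (\<lambda>j. ?\<alpha> j + ?\<gamma>) ` {j. j < N \<and> (Suc j = h \<or> j = Suc h)}"
    unfolding odd_move_def
  proof (intro arg_cong2[where f = "(\<union>)"] refl)
    show "{\<alpha> \<in> ?\<alpha> ` {..<N}. form m n \<alpha> ?\<gamma> = 0 \<and> \<alpha> \<noteq> ?\<gamma>} =
        ?\<alpha> ` {j. j < N \<and> j \<noteq> h \<and> \<not> (Suc j = h \<or> j = Suc h)}"
    proof -
      have "{\<alpha> \<in> ?\<alpha> ` {..<N}. form m n \<alpha> ?\<gamma> = 0 \<and> \<alpha> \<noteq> ?\<gamma>} =
          ?\<alpha> ` {j \<in> {..<N}. form m n (?\<alpha> j) ?\<gamma> = 0 \<and> ?\<alpha> j \<noteq> ?\<gamma>}"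
        by (rule Collect_image_eq)
      also have "{j \<in> {..<N}. form m n (?\<alpha> j) ?\<gamma> = 0 \<and> ?\<alpha> j \<noteq> ?\<gamma>} =
          {j. j < N \<and> j \<noteq> h \<and> \<not> (Suc j = h \<or> j = Suc h)}"
        using kept by (intro Collect_cong) (metis lessThan_iff)
      finally show ?thesis .
    qed
    show "{\<alpha> + ?\<gamma> |\<alpha>. \<alpha> \<in> ?\<alpha> ` {..<N} \<and> form m n \<alpha> ?\<gamma> \<noteq> 0} =
        (\<lambda>j. ?\<alpha> j + ?\<gamma>) ` {j. j < N \<and> (Suc j = h \<or> j = Suc h)}"
    proof -
      have "{\<alpha> + ?\<gamma> |\<alpha>. \<alpha> \<in> ?\<alpha> ` {..<N} \<and> form m n \<alpha> ?\<gamma> \<noteq> 0} =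
          (\<lambda>j. ?\<alpha> j + ?\<gamma>) ` {j \<in> {..<N}. form m n (?\<alpha> j) ?\<gamma> \<noteq> 0}"
        by (rule translated_image)
      also have "{j \<in> {..<N}. form m n (?\<alpha> j) ?\<gamma> \<noteq> 0} = {j. j < N \<and> (Suc j = h \<or> j = Suc h)}"
        using neighbour by (intro Collect_cong) (metis lessThan_iff)
      finally show ?thesis .
    qed
  qed
  also have "\<dots> = ?\<beta> ` {..<N}"
  proof -
    have "{..<N} = {h} \<union> {j. j < N \<and> j \<noteq> h \<and> \<not> (Suc j = h \<or> j = Suc h)}
        \<union> {j. j < N \<and> (Suc j = h \<or> j = Suc h)}"
      using h by auto
    then have "?\<beta> ` {..<N} = {?\<beta> h} \<union> ?\<beta> ` {j. j < N \<and> j \<noteq> h \<and> \<not> (Suc j = h \<or> j = Suc h)}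
        \<union> ?\<beta> ` {j. j < N \<and> (Suc j = h \<or> j = Suc h)}"
      by (metis (no_types, lifting) image_Un image_insert image_empty)
    also have "\<dots> = {- ?\<gamma>} \<union> ?\<alpha> ` {j. j < N \<and> j \<noteq> h \<and> \<not> (Suc j = h \<or> j = Suc h)}
        \<union> (\<lambda>j. ?\<alpha> j + ?\<gamma>) ` {j. j < N \<and> (Suc j = h \<or> j = Suc h)}"
      by (intro arg_cong2[where f = "(\<union>)"] image_cong refl) (auto simp: \<beta>)
    finally show ?thesis ..
  qed
  finally show ?thesis .
qed

text \<open>
  An additive map that takes letters to letters and respects heights carries the letter of
  height \<open>h\<close> for \<open>f\<close> to the letter of height \<open>h\<close> for \<open>g\<close>, hence carries base to base.
\<close>

lemma base_image:
  fixes s :: "'k::field_char_0 weight \<Rightarrow> 'k weight"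
  assumes f: "f \<in> heights (m + n)" and g: "g \<in> heights (m + n)" and s: "additive s"
    and letters: "\<And>a. a \<in> letters m n \<Longrightarrow> s a \<in> letters m n"
    and ht: "\<And>a. a \<in> letters m n \<Longrightarrow> height m n g (s a) = height m n f a"
  shows "s ` base m n f = base m n g"
proof -
  have "letter_at m n g h = s (letter_at m n f h)" if "h \<le> m + n" for h
  proof (cases "h = 0")
    case False
    then have "letter_at m n f h \<in> (letters m n :: 'k weight set)"
      "height m n f (letter_at m n f h :: 'k weight) = of_nat h"
      using letter_at[OF f] that by auto
    then show ?thesis using letters ht by (intro letter_at_eqI[OF g]) auto
  qed (simp add: additive.zero[OF s])
  then show ?thesis
    unfolding base_def image_image by (intro image_cong) (auto simp: additive.diff[OF s])
qed

lemma additive_reflection: "additive (reflection m n \<alpha>)"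
  by (auto simp: additive_def reflection_def form_linear fun_eq_iff algebra_simps add_divide_distrib)

lemma reflection_uminus: "reflection m n (- \<alpha>) = reflection m n \<alpha>"
  by (auto simp: reflection_def form_linear fun_eq_iff)

lemma bas_norm_nonzero: "bas_norm m k \<noteq> (0 :: 'k::field_char_0)"
  by (simp add: bas_norm_def)

lemma reflection_flip:
  assumes i: "i \<in> {1..m + n}" and j: "j \<in> {1..m + n}"
    and \<alpha>: "\<alpha> = bas m i \<or> \<alpha> = - (bas m i + bas m i)"
  shows "reflection m n \<alpha> (bas m j) = (if j = i then - bas m j else bas m j :: 'k::field_char_0 weight)"
proof -
  have "reflection m n (bas m i) (bas m j) = (if j = i then - bas m j else bas m j :: 'k weight)"
    using i j bas_norm_nonzero[of m i, where ?'k = 'k]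
    by (simp add: reflection_def form_bas_bas fun_eq_iff)
  moreover have "reflection m n (- (bas m i + bas m i)) = (reflection m n (bas m i) :: 'k weight \<Rightarrow> _)"
    using bas_norm_nonzero[of m i, where ?'k = 'k]
    unfolding reflection_def form_linear by (simp add: fun_eq_iff form_bas_bas i divide_simps)
  ultimately show ?thesis using \<alpha> by auto
qed

lemma reflection_swap:
  assumes i: "i \<in> {1..m + n}" "i' \<in> {1..m + n}" "i \<noteq> i'" and j: "j \<in> {1..m + n}"
    and norm: "bas_norm m i = (bas_norm m i' :: 'k::field_char_0)"
  shows "reflection m n (bas m i - bas m i') (bas m j) = (bas m (transpose i i' j) :: 'k weight)"
proof -
  let ?q = "bas_norm m i :: 'k" and ?\<alpha> = "bas m i - bas m i' :: 'k weight"
  have "form m n ?\<alpha> ?\<alpha> = 2 * ?q"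
    using i norm by (simp add: form_linear form_bas_bas)
  moreover have "form m n (bas m j) ?\<alpha> = (if j = i then ?q else if j = i' then - ?q else 0)"
    using i j norm by (simp add: form_linear form_bas_bas)
  ultimately have "reflection m n ?\<alpha> (bas m j) =
      (\<lambda>x. bas m j x - (if j = i then 1 else if j = i' then -1 else 0) * ?\<alpha> x)"
    using bas_norm_nonzero[of m i, where ?'k = 'k] by (simp add: reflection_def)
  then show ?thesis
    using i(3) by (simp add: transpose_def fun_eq_iff)
qed

lemma base_reflection_flip:
  assumes f: "f \<in> heights (m + n)" and i: "i \<in> {1..m + n}"
    and \<alpha>: "\<alpha> = bas m i \<or> \<alpha> = - (bas m i + bas m i)"
  shows "reflection m n \<alpha> ` base m n f = (base m n (flip i f) :: 'k::field_char_0 weight set)"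
proof (rule base_image[OF f flip_heights[OF f i] additive_reflection])
  fix a :: "'k weight" assume "a \<in> letters m n"
  then obtain k where k: "k \<in> {1..m + n}" "a \<in> pm (bas m k)" by (auto simp: letters_def)
  have *: "reflection m n \<alpha> a = (if k = i then - a else a)"
    using k(2) reflection_flip[OF i k(1) \<alpha>] additive.minus[OF additive_reflection, of m n \<alpha> "bas m k"]
    by (auto simp: pm_def)
  then show "reflection m n \<alpha> a \<in> letters m n" using \<open>a \<in> letters m n\<close> letters_uminus by auto
  consider "a = bas m k" | "a = - bas m k" using k(2) by (auto simp: pm_def)
  then show "height m n (flip i f) (reflection m n \<alpha> a) = height m n f a"
    unfolding * by cases (simp_all add: height_minus height_bas[OF k(1)] height_bas[OF i] flip_def)
qed

lemma base_reflection_swap: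
  assumes f: "f \<in> heights (m + n)" and i: "i \<in> {1..m + n}" "i' \<in> {1..m + n}" "i \<noteq> i'"
    and norm: "bas_norm m i = (bas_norm m i' :: 'k::field_char_0)"
  shows "reflection m n (bas m i - bas m i') ` base m n f = (base m n (swap i i' f) :: 'k weight set)"
proof (rule base_image[OF f swap_heights[OF f i(1,2)] additive_reflection])
  fix a :: "'k weight" assume "a \<in> letters m n"
  then obtain k where k: "k \<in> {1..m + n}" "a \<in> pm (bas m k)" by (auto simp: letters_def)
  have k': "transpose i i' k \<in> {1..m + n}" using k i by (auto simp: transpose_def)
  have *: "reflection m n (bas m i - bas m i') (bas m k :: 'k weight) = bas m (transpose i i' k)"
    "reflection m n (bas m i - bas m i') (- bas m k :: 'k weight) = - bas m (transpose i i' k)"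
    using reflection_swap[OF i k(1) norm] additive.minus[OF additive_reflection, of m n "bas m i - bas m i'" "bas m k :: 'k weight"]
    by simp_all
  then have "reflection m n (bas m i - bas m i') a \<in> pm (bas m (transpose i i' k))"
    using k(2) by (auto simp: pm_def)
  then show "reflection m n (bas m i - bas m i') a \<in> letters m n" using k' by (auto simp: letters_def)
  have "swap i i' f (transpose i i' k) = f k" using i by (auto simp: swap_def transpose_def)
  then show "height m n (swap i i' f) (reflection m n (bas m i - bas m i') a) = height m n f a"
    using k(2) by (auto simp: pm_def * height_minus height_bas[OF k(1)] height_bas[OF k'])
qed

text \<open>
  If the values at \<open>i\<close> and \<open>i'\<close> differ by 1, the letters of the basis vectors \<open>i\<close> and \<open>i'\<close> occupy
  two adjacent places with equal signs, and exchanging the values exchanges these places. For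
  positive values the larger height belongs to \<open>i\<close>; for negative values the letters are the
  negatives and the order is reversed.
\<close>

lemma letter_at_swap:
  assumes f: "f \<in> heights (m + n)" and i: "i \<in> {1..m + n}" "i' \<in> {1..m + n}"
    and h: "0 < h" and fi: "f i = int (Suc h) \<and> f i' = int h \<or> f i = - int h \<and> f i' = - int (Suc h)"
    and k: "k \<le> m + n"
  shows "letter_at m n (swap i i' f) k = (letter_at m n f (transpose h (Suc h) k) :: 'k::field_char_0 weight)"
proof (cases "k = 0")
  case False
  let ?k = "transpose h (Suc h) k" and ?a = "letter_at m n f (transpose h (Suc h) k) :: 'k weight"
  have "\<bar>f i\<bar> \<in> {1..int (m + n)}" "\<bar>f i'\<bar> \<in> {1..int (m + n)}"
    using f i unfolding heights_def bij_betw_def by blast+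
  then have "Suc h \<le> m + n" using fi by auto
  then have k': "0 < ?k" "?k \<le> m + n" using False k h by (auto simp: transpose_def)
  note a = letter_at[OF f k', where ?'k = 'k]
  obtain j where j: "j \<in> {1..m + n}" "?a \<in> pm (bas m j)" using a(1) by (auto simp: letters_def)
  have ne: "i \<noteq> i'" using fi by auto
  have "height m n (swap i i' f) ?a = of_nat k"
  proof -
    \<comment> \<open>\<open>s\<close> is the sign with which the basis vector \<open>j\<close> occurs in the letter.\<close>
    obtain s :: int where s: "s = 1 \<or> s = -1" "\<And>g. height m n g ?a = of_int (s * g j)"
      using j(2) that[of 1] that[of "-1"] by (auto simp: pm_def height_minus height_bas[OF j(1)])
    have "s * f j = int ?k" using s(2)[of f] a(2) by linarith
    moreover have "\<bar>f j\<bar> = int ?k" using s(1) calculation by auto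
    moreover have "\<bar>f j\<bar> = \<bar>f i\<bar> \<longleftrightarrow> j = i" "\<bar>f j\<bar> = \<bar>f i'\<bar> \<longleftrightarrow> j = i'"
      using heights_abs_eq[OF f j(1)] i by auto
    ultimately have j: "s * f j = int ?k" "\<bar>f j\<bar> = int ?k" "\<bar>f j\<bar> = \<bar>f i\<bar> \<longleftrightarrow> j = i" "\<bar>f j\<bar> = \<bar>f i'\<bar> \<longleftrightarrow> j = i'"
      by blast+
    have "s * swap i i' f j = int k"
    proof (cases "j = i \<or> j = i'")
      case True
      then have "\<bar>f j\<bar> = int h \<or> \<bar>f j\<bar> = int (Suc h)" using fi by auto
      then have "?k = h \<or> ?k = Suc h" using j(2) by linarith
      then consider "?k = h" "k = Suc h" | "?k = Suc h" "k = h"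
        by (metis transpose_apply_first transpose_apply_second transpose_involutory)
      then show ?thesis
      proof cases
        case 1
        with fi have v: "f i = int (Suc h) \<and> f i' = int h \<or> f i = - int h \<and> f i' = - int (Suc h)" "s * f j = int h"
          using j(1) by simp_all
        show ?thesis
          using True by (elim disjE) (use v s(1) h ne 1 in \<open>auto simp: swap_def\<close>)
      next
        case 2
        with fi have v: "f i = int (Suc h) \<and> f i' = int h \<or> f i = - int h \<and> f i' = - int (Suc h)" "s * f j = int (Suc h)"
          using j(1) by simp_all
        show ?thesis
          using True by (elim disjE) (use v s(1) h ne 2 in \<open>auto simp: swap_def\<close>)
      qed
    next
      case False
      then have "int ?k \<noteq> \<bar>f i\<bar>" "int ?k \<noteq> \<bar>f i'\<bar>" using j by auto
      then have "?k \<noteq> h" "?k \<noteq> Suc h" using fi by auto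
      then have "?k = k" by (auto simp: transpose_def split: if_splits)
      then show ?thesis using False j(1) by (simp add: swap_def)
    qed
    then show ?thesis using s(2)[of "swap i i' f"] by linarith
  qed
  then show ?thesis using letter_at_eqI[OF swap_heights[OF f i] a(1)] by blast
qed (use h in simp)

section \<open>The generating reflections act as the moves\<close>

text \<open>
  The root \<open>bas m i - bas m i'\<close> of height 1 is the difference of the letters at two adjacent
  places, whichever sign the two vectors have. One of these letters is of type \<open>\<delta>\<close> and the other
  of type \<open>\<epsilon>\<close>, which makes the difference isotropic.
\<close>

lemma base_odd_move:
  assumes f: "f \<in> heights (m + n)" and i: "i \<in> {1..m + n}" "i' \<in> {1..m + n}"
    and norm: "bas_norm m i = - (bas_norm m i' :: 'k::field_char_0)"
    and next_to: "f i = f i' + 1"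
  shows "odd_move m n (bas m i - bas m i') (base m n f) = (base m n (swap i i' f) :: 'k weight set)"
proof -
  note eqI = letter_at_eqI[OF f, where ?'k = 'k]
  have mem: "(bas m k :: 'k weight) \<in> letters m n" "- (bas m k :: 'k weight) \<in> letters m n"
    if "k \<in> {1..m + n}" for k
    using that by (auto simp: letters_def pm_def)
  have abs: "\<bar>f i\<bar> \<in> {1..int (m + n)}" "\<bar>f i'\<bar> \<in> {1..int (m + n)}"
    using f i unfolding heights_def bij_betw_def by blast+
  have form_i: "form m n (bas m i) (bas m i) = - (form m n (bas m i') (bas m i') :: 'k)"
    using i norm by (simp add: form_bas_bas)
  obtain h where h: "0 < h" "Suc h \<le> m + n"
    and fi: "f i = int (Suc h) \<and> f i' = int h \<or> f i = - int h \<and> f i' = - int (Suc h)"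
    and \<gamma>: "bas m i - bas m i' = letter_at m n f (Suc h) - (letter_at m n f h :: 'k weight)"
    and iso: "form m n (letter_at m n f (Suc h)) (letter_at m n f (Suc h)) =
      - (form m n (letter_at m n f h) (letter_at m n f h) :: 'k)"
  proof (cases "f i' > 0")
    case True
    define h where "h = nat (f i')"
    have h: "f i' = int h" "f i = int (Suc h)" "0 < h" "Suc h \<le> m + n"
      using True next_to abs by (auto simp: h_def)
    have "letter_at m n f (Suc h) = (bas m i :: 'k weight)" "letter_at m n f h = (bas m i' :: 'k weight)"
      using h i by (auto intro!: eqI mem simp: height_bas)
    then show thesis using that[of h] h form_i by simp
  next
    case False
    define h where "h = nat (- f i)"
    have h: "f i' = - int (Suc h)" "f i = - int h" "0 < h" "Suc h \<le> m + n"
      using False next_to abs by (auto simp: h_def)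
    have "letter_at m n f (Suc h) = (- bas m i' :: 'k weight)" "letter_at m n f h = (- bas m i :: 'k weight)"
      using h i by (auto intro!: eqI mem simp: height_bas height_minus)
    then show thesis using that[of h] h form_i by (simp add: form_linear)
  qed
  have "odd_move m n (bas m i - bas m i') (base m n f) =
      (\<lambda>j. ((letter_at m n f :: nat \<Rightarrow> 'k weight) \<circ> transpose h (Suc h)) (Suc j)
         - ((letter_at m n f :: nat \<Rightarrow> 'k weight) \<circ> transpose h (Suc h)) j) ` {..<m + n}"
    unfolding \<gamma> base_def
    using h by (intro odd_move_chain iso form_letter_at[OF f] form_letter_at_self[OF f]) auto
  also have "\<dots> = base m n (swap i i' f)"
    unfolding base_def
    by (intro image_cong) (auto simp: letter_at_swap[OF f i h(1) fi])
  finally show ?thesis .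
qed

text \<open>
  The root or its negative belongs to the base exactly if its height is 1 or -1, which is the
  condition under which the odd exchange does something.
\<close>

lemma base_odd_reflection:
  assumes f: "f \<in> heights (m + n)" and i: "i \<in> {1..m + n}" "i' \<in> {1..m + n}"
    and norm: "bas_norm m i = - (bas_norm m i' :: 'k::field_char_0)"
  shows "odd_reflection m n (bas m i - bas m i') (base m n f) = (base m n (odd_swap i i' f) :: 'k weight set)"
proof -
  have ne: "i \<noteq> i'" using norm by (auto simp: bas_norm_def split: if_splits)
  have root: "bas m i - bas m i' \<in> (roots m n :: 'k weight set)" "bas m i' - bas m i \<in> (roots m n :: 'k weight set)"
    using roots_sum[OF i ne, of "bas m i :: 'k weight" "- bas m i'"]
      roots_sum[OF i(2,1), of "bas m i' :: 'k weight" "- bas m i"] ne by (auto simp: pm_def)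
  have mem: "bas m i - bas m i' \<in> (base m n f :: 'k weight set) \<longleftrightarrow> f i = f i' + 1"
    "bas m i' - bas m i \<in> (base m n f :: 'k weight set) \<longleftrightarrow> f i' = f i + 1"
    using root by (auto simp: base_eq_height_1[OF f] height_diff height_bas[OF i(1)] height_bas[OF i(2)])
  consider "f i = f i' + 1" | "f i' = f i + 1" | "\<not> neighbours (f i) (f i')"
    unfolding neighbours_def by linarith
  then show ?thesis
  proof cases
    case 1
    then show ?thesis
      using mem base_odd_move[OF f i norm] by (simp add: odd_reflection_def odd_swap_def neighbours_def)
  next
    case 2
    then show ?thesis
      using mem base_odd_move[OF f i(2,1), where ?'k = 'k] norm
      by (simp add: odd_reflection_def odd_swap_def neighbours_def swap_commute)
  next
    case 3
    then have "f i \<noteq> f i' + 1" "f i' \<noteq> f i + 1" by (auto simp: neighbours_def)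
    then show ?thesis using mem 3 by (simp add: odd_reflection_def odd_swap_def)
  qed
qed

text \<open>
  The extended system in the order of the chain: \<open>-2\<delta>\<^sub>1\<close> comes first, and the reflection in the
  \<open>k\<close>-th root acts on heights as the move \<open>gen m n k\<close>.
\<close>

definition chain_root :: "nat \<Rightarrow> nat \<Rightarrow> nat \<Rightarrow> 'k::field_char_0 weight" where
  "chain_root m n k =
     (if k = 0 then - (bas m 1 + bas m 1) else if k = m + n then bas m (m + n)
      else bas m k - bas m (k + 1))"

lemma isotropic_form:
  assumes "\<alpha> \<in> isotropic_odd_roots m n"
  shows "form m n \<alpha> \<alpha> = (0 :: 'k::field_char_0)"
proof -
  obtain a b i j where *: "i \<in> {1..m}" "j \<in> {1..n}" "a \<in> pm (\<delta> i)" "b \<in> pm (\<epsilon> j)" "\<alpha> = a + b"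
    using assms unfolding isotropic_odd_roots_def by blast
  then have ab: "a \<in> pm (bas m i)" "b \<in> pm (bas m (m + j))" by (auto simp: bas_delta bas_eps)
  have ij: "i \<in> {1..m + n}" "m + j \<in> {1..m + n}" "i \<noteq> m + j" using * by auto
  have "form m n a b = 0" "form m n a a = 1" "form m n b b = -1"
    using form_pm[OF ij(1,2) ab] form_pm[OF ij(2,1) ab(2,1)] ij * by (auto simp: bas_norm_def)
  then show ?thesis by (simp add: *(5) form_linear form_commute[of m n b a])
qed

text \<open>
  All members of the chain except \<open>\<delta>\<^sub>m - \<epsilon>\<^sub>1\<close> have nonzero norm, whereas the isotropic odd roots
  have norm zero.
\<close>

lemma chain_root_isotropic:
  assumes "k \<le> m + n" "m > 0" "n > 0"
  shows "chain_root m n k \<in> (isotropic_odd_roots m n :: 'k::field_char_0 weight set) \<longleftrightarrow> k = m"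
proof
  assume "k = m"
  then have "chain_root m n k = \<delta> m + - (\<epsilon> 1 :: 'k weight)"
    using assms by (simp add: chain_root_def bas_delta bas_eps)
  moreover have "\<exists>i\<in>{1..m}. \<exists>j\<in>{1..n}. \<delta> m \<in> pm (\<delta> i) \<and> - (\<epsilon> 1 :: 'k weight) \<in> pm (\<epsilon> j)"
    using assms by (intro bexI[of _ m] bexI[of _ 1]) (auto simp: pm_def)
  ultimately show "chain_root m n k \<in> (isotropic_odd_roots m n :: 'k weight set)"
    unfolding isotropic_odd_roots_def by blast
next
  assume "chain_root m n k \<in> (isotropic_odd_roots m n :: 'k weight set)"
  then have z: "form m n (chain_root m n k) (chain_root m n k) = (0 :: 'k)"
    by (rule isotropic_form)
  have "form m n (chain_root m n k) (chain_root m n k) \<noteq> (0 :: 'k)" if "k \<noteq> m"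
  proof -
    have "form m n (bas m 1) (bas m 1) = (1 :: 'k)" "form m n (bas m (m + n)) (bas m (m + n)) = (-1 :: 'k)"
      using assms by (simp_all add: form_bas_bas bas_norm_def)
    moreover have "form m n (- (bas m 1 + bas m 1)) (- (bas m 1 + bas m 1)) = (4 * form m n (bas m 1) (bas m 1) :: 'k)"
      by (simp only: form_linear) simp
    moreover have "form m n (bas m k - bas m (k + 1)) (bas m k - bas m (k + 1)) = (2 * bas_norm m k :: 'k)"
      if "0 < k" "k < m + n"
      using that \<open>k \<noteq> m\<close> by (simp add: form_linear form_bas_bas bas_norm_def)
    ultimately show ?thesis
      using assms by (auto simp: chain_root_def bas_norm_nonzero simp del: One_nat_def)
  qed
  then show "k = m" using z by blast
qed

lemma chain_root_in_roots:
  assumes "k \<le> m + n" "m > 0" "n > 0"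
  shows "chain_root m n k \<in> (roots m n :: 'k::field_char_0 weight set)"
proof -
  consider "k = 0" | "k = m + n" | "0 < k" "k < m + n" using assms by linarith
  then show ?thesis
  proof cases
    case 1
    then show ?thesis
      using roots_double[of 1 m "- bas m 1 :: 'k weight" n] assms
      by (simp add: chain_root_def pm_def)
  next
    case 2
    moreover have "(bas m (m + n) :: 'k weight) \<in> letters m n"
      unfolding letters_def pm_def using assms by (intro UN_I[of "m + n"]) auto
    ultimately show ?thesis
      using assms by (simp add: chain_root_def roots_letter)
  next
    case 3
    then show ?thesis
      using roots_sum[of k m n "k + 1" "bas m k :: 'k weight" "- bas m (k + 1)"]
      by (simp add: chain_root_def pm_def)
  qed
qed

lemma r_hat_base:
  assumes f: "f \<in> heights (m + n)" and k: "k \<le> m + n" and pos: "m > 0" "n > 0"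
  shows "r_hat m n (chain_root m n k) (base m n f) = (base m n (gen m n k f) :: 'k::field_char_0 weight set)"
proof -
  have B: "(base m n f :: 'k weight set) \<in> borels m n" using f by (simp add: borels_eq)
  consider "k = m" | "k = 0" | "k = m + n" | "k \<noteq> m" "0 < k" "k < m + n" using k by linarith
  then show ?thesis
  proof cases
    case 1
    then have "r_hat m n (chain_root m n k) (base m n f) = odd_reflection m n (bas m m - bas m (m + 1)) (base m n f :: 'k weight set)"
      using B pos chain_root_isotropic[OF k pos, where ?'k = 'k] by (simp add: r_hat_def chain_root_def)
    also have "\<dots> = base m n (odd_swap m (m + 1) f)"
      using pos by (intro base_odd_reflection[OF f]) (auto simp: bas_norm_def)
    finally show ?thesis using 1 pos by (simp add: gen_def)
  next
    case 2
    then have "r_hat m n (chain_root m n k) (base m n f) = reflection m n (- (bas m 1 + bas m 1)) ` (base m n f :: 'k weight set)"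
      using B pos chain_root_isotropic[OF k pos, where ?'k = 'k] by (simp add: r_hat_def chain_root_def)
    also have "\<dots> = base m n (flip 1 f)"
      using pos by (intro base_reflection_flip[OF f]) auto
    finally show ?thesis using 2 by (simp add: gen_def)
  next
    case 3
    then have "r_hat m n (chain_root m n k) (base m n f) = reflection m n (bas m (m + n)) ` (base m n f :: 'k weight set)"
      using B pos chain_root_isotropic[OF k pos, where ?'k = 'k] by (simp add: r_hat_def chain_root_def)
    also have "\<dots> = base m n (flip (m + n) f)"
      using pos by (intro base_reflection_flip[OF f]) auto
    finally show ?thesis using 3 pos by (simp add: gen_def)
  next
    case 4
    then have "r_hat m n (chain_root m n k) (base m n f) = reflection m n (bas m k - bas m (k + 1)) ` (base m n f :: 'k weight set)"
      using B pos chain_root_isotropic[OF k pos, where ?'k = 'k] by (simp add: r_hat_def chain_root_def)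
    also have "\<dots> = base m n (swap k (k + 1) f)"
      using 4 by (intro base_reflection_swap[OF f]) (auto simp: bas_norm_def)
    finally show ?thesis using 4 by (simp add: gen_def)
  qed
qed

section \<open>Orders in the super Weyl group and the Coxeter graph\<close>

definition chain_map :: "nat \<Rightarrow> nat \<Rightarrow> nat \<Rightarrow> 'k::field_char_0 borel_map" where
  "chain_map m n k = r_hat m n (chain_root m n k)"

text \<open>
  The entries of the Coxeter matrix off the diagonal.
\<close>

definition bond :: "nat \<Rightarrow> nat \<Rightarrow> nat \<Rightarrow> nat \<Rightarrow> nat" where
  "bond m n j k = (if k = j + 1 then label m n j else if j = k + 1 then label m n k else 2)"

definition edge_label :: "nat \<Rightarrow> nat \<Rightarrow> nat \<Rightarrow> nat option" where
  "edge_label m n k = (if label m n k = 3 then None else Some (label m n k))"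

context
  fixes m n :: nat
  assumes pos: "m > 0" "n > 0"
begin

lemma chain_map_base:
  "f \<in> heights (m + n) \<Longrightarrow> k \<le> m + n \<Longrightarrow>
    chain_map m n k (base m n f) = (base m n (gen m n k f) :: 'k::field_char_0 weight set)"
  unfolding chain_map_def by (rule r_hat_base[OF _ _ pos])

lemma chain_map_Bij:
  assumes "k \<le> m + n"
  shows "(chain_map m n k :: 'k::field_char_0 borel_map) \<in> Bij (borels m n)"
proof -
  have gen: "gen m n k f \<in> heights (m + n)" if "f \<in> heights (m + n)" for f
    using gen_heights[OF that assms] pos by simp
  have maps: "(chain_map m n k :: 'k borel_map) ` borels m n \<subseteq> borels m n"
    unfolding borels_eq using gen by (auto simp: chain_map_base assms)
  have "chain_map m n k (chain_map m n k B) = B" if "B \<in> borels m n" for B :: "'k weight set"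
    using that unfolding borels_eq by (auto simp: chain_map_base assms gen gen_involution)
  then have "bij_betw (chain_map m n k :: 'k borel_map) (borels m n) (borels m n)"
    using maps by (intro bij_betw_byWitness[where f' = "chain_map m n k"]) auto
  then show ?thesis
    by (simp add: Bij_def chain_map_def r_hat_def)
qed

abbreviation W :: "'k::field_char_0 borel_map monoid" where
  "W \<equiv> super_weyl_group m n"

lemma group_W: "group (W :: 'k::field_char_0 borel_map monoid)"
  unfolding super_weyl_group_def
  by (rule group.group_subgroup_generated[OF group_BijGroup])

lemma carrier_W: "x \<in> carrier (W :: 'k::field_char_0 borel_map monoid) \<Longrightarrow> x \<in> Bij (borels m n)"
  using group.carrier_subgroup_generated_subset[OF group_BijGroup]
  by (auto simp: super_weyl_group_def BijGroup_def)

lemma chain_map_carrier: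
  assumes "k \<le> m + n"
  shows "chain_map m n k \<in> carrier (W :: 'k::field_char_0 borel_map monoid)"
proof -
  have "(chain_map m n k :: 'k borel_map) \<in> r_hat m n ` roots m n"
    using chain_root_in_roots[OF assms pos] by (auto simp: chain_map_def)
  then show ?thesis
    using chain_map_Bij[OF assms]
    by (auto simp: super_weyl_group_def carrier_subgroup_generated BijGroup_def intro: generate.incl)
qed

lemma mult_W:
  assumes "x \<in> carrier W" "y \<in> carrier W" "B \<in> borels m n"
  shows "(x \<otimes>\<^bsub>W\<^esub> y) B = x (y B :: 'k::field_char_0 weight set)"
  using carrier_W[OF assms(1)] carrier_W[OF assms(2)] assms(3)
  by (simp add: super_weyl_group_def BijGroup_def compose_def)

lemma one_W: "\<one>\<^bsub>W\<^esub> = (\<lambda>B\<in>borels m n. B :: 'k::field_char_0 weight set)"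
  by (simp add: super_weyl_group_def BijGroup_def)

text \<open>
  Since \<open>base\<close> is a bijection from the height functions to the Borel subalgebras, the powers of a
  product of two generators are computed on height functions.
\<close>

lemma order_chain_map:
  assumes jk: "j \<le> m + n" "k \<le> m + n"
    and ord: "has_order (heights (m + n)) (gen m n j \<circ> gen m n k) d"
  shows "coxeter_matrix m n (chain_map m n j) (chain_map m n k :: 'k::field_char_0 borel_map) = d"
proof -
  interpret group "W :: 'k borel_map monoid" by (rule group_W)
  let ?T = "gen m n j \<circ> gen m n k"
  let ?x = "chain_map m n j \<otimes>\<^bsub>W\<^esub> chain_map m n k :: 'k borel_map"
  note carrier = chain_map_carrier[OF jk(1), where ?'k = 'k] chain_map_carrier[OF jk(2), where ?'k = 'k]
  have x: "?x \<in> carrier W" using carrier by simp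
  have T: "?T f \<in> heights (m + n)" if "f \<in> heights (m + n)" for f
    using that jk pos by (simp add: gen_heights)
  have step: "?x (base m n f) = base m n (?T f)" if f: "f \<in> heights (m + n)" for f
  proof -
    have "gen m n k f \<in> heights (m + n)" "(base m n f :: 'k weight set) \<in> borels m n"
      using f jk pos by (simp_all add: gen_heights borels_eq)
    then show ?thesis
      using mult_W[OF carrier] f jk by (simp add: chain_map_base)
  qed
  have Tp: "(?T ^^ p) f \<in> heights (m + n)" if "f \<in> heights (m + n)" for f p
    using that by (induction p) (simp_all add: T[unfolded o_apply])
  have pow: "(?x [^]\<^bsub>W\<^esub> p) (base m n f) = (base m n ((?T ^^ p) f) :: 'k weight set)"
    if "f \<in> heights (m + n)" for f p
    using that
  proof (induction p arbitrary: f)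
    case 0
    then show ?case by (simp add: one_W borels_eq)
  next
    case (Suc p)
    have "(?x [^]\<^bsub>W\<^esub> Suc p) (base m n f) = (?x [^]\<^bsub>W\<^esub> p) (?x (base m n f))"
      using Suc.prems x by (simp add: mult_W borels_eq del: o_apply)
    also have "\<dots> = base m n ((?T ^^ p) (?T f))"
      using Suc.IH[OF T[OF Suc.prems]] by (simp only: step[OF Suc.prems])
    also have "(?T ^^ p) (?T f) = (?T ^^ Suc p) f"
      by (simp only: funpow_Suc_right o_apply)
    finally show ?case .
  qed
  have "?x [^]\<^bsub>W\<^esub> p = \<one>\<^bsub>W\<^esub> \<longleftrightarrow> (\<forall>f\<in>heights (m + n). (?T ^^ p) f = f)" for p :: nat
  proof -
    have "?x [^]\<^bsub>W\<^esub> p \<in> extensional (borels m n)" "\<one>\<^bsub>W\<^esub> \<in> (extensional (borels m n) :: 'k borel_map set)"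
      using carrier_W[OF nat_pow_closed[OF x]] by (auto simp: Bij_def one_W)
    then have "?x [^]\<^bsub>W\<^esub> p = \<one>\<^bsub>W\<^esub> \<longleftrightarrow>
        (\<forall>B\<in>borels m n. (?x [^]\<^bsub>W\<^esub> p) B = (\<one>\<^bsub>W\<^esub> :: 'k borel_map) B)"
      using extensionalityI by metis
    also have "\<dots> \<longleftrightarrow> (\<forall>f\<in>heights (m + n). (base m n ((?T ^^ p) f) :: 'k weight set) = base m n f)"
      by (simp add: one_W borels_eq pow del: o_apply)
    also have "\<dots> \<longleftrightarrow> (\<forall>f\<in>heights (m + n). (?T ^^ p) f = f)"
      using base_inj[OF Tp, where ?'k = 'k] by metis
    finally show ?thesis .
  qed
  then show ?thesis
    using ord ord_unique[OF x, of d] by (simp add: coxeter_matrix_def has_order_def)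
qed

lemma chain_map_inj:
  assumes "j < k" "k \<le> m + n"
  shows "(chain_map m n j :: 'k::field_char_0 borel_map) \<noteq> chain_map m n k"
proof
  assume eq: "(chain_map m n j :: 'k borel_map) = chain_map m n k"
  obtain f where f: "f \<in> heights (m + n)" "gen m n j f \<noteq> gen m n k f"
    using gen_distinct[OF assms pos] by blast
  have "(base m n (gen m n j f) :: 'k weight set) = base m n (gen m n k f)"
    using chain_map_base[OF f(1), of j, where ?'k = 'k] chain_map_base[OF f(1), of k, where ?'k = 'k] eq assms
    by simp
  then have "gen m n j f = gen m n k f"
    using f(1) assms pos by (intro base_inj) (auto simp: gen_heights)
  then show False using f(2) by simp
qed

lemma inj_on_chain_map: "inj_on (chain_map m n :: nat \<Rightarrow> 'k::field_char_0 borel_map) {..m + n}"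
  using chain_map_inj by (intro linorder_inj_onI) auto

lemma coxeter_matrix_chain_map:
  assumes "j \<noteq> k" "j \<le> m + n" "k \<le> m + n"
  shows "coxeter_matrix m n (chain_map m n j) (chain_map m n k :: 'k::field_char_0 borel_map) = bond m n j k"
proof -
  have "has_order (heights (m + n)) (gen m n j \<circ> gen m n k) (bond m n j k)"
    if "j < k" "k \<le> m + n" for j k
    using order_gen_Suc[of j m n] order_gen_far[of j k m n] that pos
    by (cases "k = j + 1") (auto simp: bond_def)
  moreover have "has_order (heights (m + n)) (gen m n j \<circ> gen m n k) (bond m n j k)"
    if "k < j" "j \<le> m + n" for j k
  proof (rule has_order_commute)
    show "has_order (heights (m + n)) (gen m n k \<circ> gen m n j) (bond m n j k)"
      using calculation[OF that] by (auto simp: bond_def)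
  qed (use that pos in \<open>simp_all add: gen_heights gen_involution\<close>)
  ultimately show ?thesis
    using assms by (intro order_chain_map) (auto simp: neq_iff)
qed

lemma edge_label_eq: "(if label m n k \<ge> 4 then Some (label m n k) else None) = edge_label m n k"
  by (simp add: edge_label_def label_def)

lemma bond_ge_3: "bond m n j k \<ge> 3 \<longleftrightarrow> k = j + 1 \<or> j = k + 1"
  by (auto simp: bond_def label_def)

lemma extended_system_eq: "extended_system m n = (chain_root m n :: nat \<Rightarrow> 'k::field_char_0 weight) ` {..m + n}"
proof -
  have split: "{..m + n} = {0} \<union> {1..<m} \<union> {m} \<union> (\<lambda>j. m + j) ` {1..<n} \<union> {m + n}"
  proof -
    have "(\<lambda>j. m + j) ` {1..<n} = {m + 1..<m + n}" by (simp add: image_add_atLeastLessThan add.commute)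
    then show ?thesis using pos by auto
  qed
  have "(chain_root m n :: nat \<Rightarrow> 'k weight) ` {..m + n} =
      {- (\<delta> 1 + \<delta> 1)} \<union> (\<lambda>i. \<delta> i - \<delta> (i + 1)) ` {1..<m} \<union> {\<delta> m - \<epsilon> 1}
      \<union> (\<lambda>j. \<epsilon> j - \<epsilon> (j + 1)) ` {1..<n} \<union> {\<epsilon> n}"
    unfolding split image_Un image_image
    using pos by (intro arg_cong2[where f = "(\<union>)"] image_cong) (auto simp: chain_root_def bas_delta bas_eps)
  then show ?thesis
    unfolding extended_system_def standard_system_def by (auto simp: Setcompr_eq_image)
qed

lemma generators_eq:
  "coxeter_generators m n = (chain_map m n :: nat \<Rightarrow> 'k::field_char_0 borel_map) ` {..m + n}"
  by (simp add: coxeter_generators_def extended_system_eq image_image chain_map_def)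

text \<open>
  The bonds are symmetric, so every edge is of the form \<open>{k, k + 1}\<close>, and all labels of consecutive
  generators are at least 3.
\<close>

lemma edges_eq:
  "edges (spo_coxeter_graph m n :: 'k::field_char_0 borel_map labelled_graph) =
    {({chain_map m n k, chain_map m n (k + 1)}, edge_label m n k) | k. k < m + n}" (is "_ = ?R")
proof -
  let ?M = "coxeter_matrix m n :: 'k borel_map \<Rightarrow> _" and ?r = "chain_map m n :: nat \<Rightarrow> 'k borel_map"
  have "edges (spo_coxeter_graph m n :: 'k borel_map labelled_graph) =
      {({x, y}, if ?M x y \<ge> 4 then Some (?M x y) else None) | x y.
        x \<in> ?r ` {..m + n} \<and> y \<in> ?r ` {..m + n} \<and> x \<noteq> y \<and> ?M x y \<ge> 3}"
    by (simp add: spo_coxeter_graph_def coxeter_graph_def generators_eq)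
  also have "\<dots> = ?R"
  proof (intro subset_antisym subsetI)
    fix e assume "e \<in> {({x, y}, if ?M x y \<ge> 4 then Some (?M x y) else None) | x y.
        x \<in> ?r ` {..m + n} \<and> y \<in> ?r ` {..m + n} \<and> x \<noteq> y \<and> ?M x y \<ge> 3}"
    then obtain j k where jk: "j \<le> m + n" "k \<le> m + n" "j \<noteq> k" "?M (?r j) (?r k) \<ge> 3"
      and e: "e = ({?r j, ?r k}, if ?M (?r j) (?r k) \<ge> 4 then Some (?M (?r j) (?r k)) else None)"
      by auto
    have M: "?M (?r j) (?r k) = bond m n j k" using coxeter_matrix_chain_map jk by blast
    then have "k = j + 1 \<or> j = k + 1" using jk(4) bond_ge_3 by simp
    then show "e \<in> ?R"
    proof
      assume "k = j + 1"
      then have "e = ({?r j, ?r (j + 1)}, edge_label m n j)" "j < m + n"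
        unfolding e M using jk by (simp_all add: bond_def edge_label_eq[symmetric])
      then show ?thesis by blast
    next
      assume "j = k + 1"
      then have "e = ({?r k, ?r (k + 1)}, edge_label m n k)" "k < m + n"
        unfolding e M using jk by (simp_all add: bond_def edge_label_eq[symmetric] insert_commute)
      then show ?thesis by blast
    qed
  next
    fix e assume "e \<in> ?R"
    then obtain k where k: "k < m + n" "e = ({?r k, ?r (k + 1)}, edge_label m n k)" by blast
    have M: "?M (?r k) (?r (k + 1)) = label m n k"
      using coxeter_matrix_chain_map[of k "k + 1", where ?'k = 'k] k by (simp add: bond_def)
    have "?r k \<noteq> ?r (k + 1)" using chain_map_inj[of k "k + 1", where ?'k = 'k] k by simp
    moreover have "label m n k \<ge> 3" by (simp add: label_def)
    ultimately show "e \<in> {({x, y}, if ?M x y \<ge> 4 then Some (?M x y) else None) | x y.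
        x \<in> ?r ` {..m + n} \<and> y \<in> ?r ` {..m + n} \<and> x \<noteq> y \<and> ?M x y \<ge> 3}"
      using k(1) unfolding k(2) edge_label_eq[symmetric] M[symmetric]
      by (intro CollectI exI[of _ "?r k"] exI[of _ "?r (k + 1)"]) simp
  qed
  finally show ?thesis .
qed

lemma is_chain_chain_map:
  "is_chain (spo_coxeter_graph m n :: 'k::field_char_0 borel_map labelled_graph)
     (map (chain_map m n) [0..<m + n + 1]) (map (edge_label m n) [0..<m + n])"
proof -
  let ?vs = "map (chain_map m n) [0..<m + n + 1] :: 'k borel_map list"
  have "distinct ?vs"
    using inj_on_chain_map[where ?'k = 'k] by (auto simp: distinct_map atLeast0LessThan lessThan_Suc_atMost simp del: upt_Suc)
  moreover have "verts (spo_coxeter_graph m n) = set ?vs"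
    by (auto simp: spo_coxeter_graph_def coxeter_graph_def generators_eq simp del: upt_Suc)
  moreover have "edges (spo_coxeter_graph m n) =
      {({?vs ! k, ?vs ! (k + 1)}, map (edge_label m n) [0..<m + n] ! k) | k. k < length (map (edge_label m n) [0..<m + n])}"
    unfolding edges_eq by (intro Collect_cong ex_cong1) (auto simp del: upt_Suc)
  ultimately show ?thesis
    unfolding is_chain_def by (auto simp del: upt_Suc intro!: labelled_graph.equality)
qed

lemma vertices_eq:
  "map (chain_map m n) [0..<m + n + 1] = [r_bar1 m n] @ map (r_\<delta>\<delta> m n) [1..<m] @ [r_\<delta>\<epsilon> m n]
     @ map (r_\<epsilon>\<epsilon> m n) [1..<n] @ [r_last m n :: 'k::field_char_0 borel_map]"
proof -
  have "[0..<m + n + 1] = [0] @ [1..<m] @ [m] @ map (\<lambda>j. j + m) [1..<n] @ [m + n]"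
  proof -
    have "[0..<m + n + 1] = [0..<m] @ [m..<m + n] @ [m + n]"
      using upt_add_eq_append[of 0 m n] by simp
    moreover have "[0..<m] = [0] @ [1..<m]" "[m..<m + n] = [m] @ [Suc m..<m + n]"
      using pos by (simp_all add: upt_conv_Cons)
    moreover have "[Suc m..<m + n] = map (\<lambda>j. j + m) [1..<n]"
      by (rule nth_equalityI) auto
    ultimately show ?thesis by simp
  qed
  moreover have "chain_map m n 0 = (r_bar1 m n :: 'k borel_map)"
  proof -
    have "- (\<delta> 1 + \<delta> 1) \<notin> (isotropic_odd_roots m n :: 'k weight set)"
      using chain_root_isotropic[of 0 m n, where ?'k = 'k] pos by (simp add: chain_root_def bas_delta)
    moreover have "\<delta> 1 + \<delta> 1 \<notin> (isotropic_odd_roots m n :: 'k weight set)"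
    proof
      assume "\<delta> 1 + \<delta> 1 \<in> (isotropic_odd_roots m n :: 'k weight set)"
      moreover have "\<delta> 1 = (bas m 1 :: 'k weight)" using pos by (simp add: bas_delta)
      ultimately have "form m n (bas m 1 + bas m 1) (bas m 1 + bas m 1) = (0 :: 'k)"
        using isotropic_form by metis
      moreover have "form m n (bas m 1 + bas m 1) (bas m 1 + bas m 1) = (4 * form m n (bas m 1) (bas m 1) :: 'k)"
        by (simp only: form_linear) simp
      ultimately show False
        using pos form_bas_bas[of 1 m n 1, where ?'a = 'k] by (simp add: bas_norm_def)
    qed
    ultimately show ?thesis
      using pos by (simp add: chain_map_def chain_root_def r_bar1_def r_hat_def bas_delta reflection_uminus)
  qed
  moreover have "chain_map m n m = (r_\<delta>\<epsilon> m n :: 'k borel_map)" "chain_map m n (m + n) = (r_last m n :: 'k borel_map)"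
    using pos by (simp_all add: chain_map_def chain_root_def r_\<delta>\<epsilon>_def r_last_def bas_delta bas_eps)
  moreover have "map (chain_map m n) [1..<m] = (map (r_\<delta>\<delta> m n) [1..<m] :: 'k borel_map list)"
    by (auto simp: chain_map_def chain_root_def r_\<delta>\<delta>_def bas_delta)
  moreover have "map (\<lambda>j. chain_map m n (j + m)) [1..<n] = (map (r_\<epsilon>\<epsilon> m n) [1..<n] :: 'k borel_map list)"
    by (auto simp: chain_map_def chain_root_def r_\<epsilon>\<epsilon>_def bas_eps)
  ultimately show ?thesis by (simp del: upt_Suc add: comp_def)
qed

lemma edge_labels_eq:
  "map (edge_label m n) [0..<m + n] =
     (if m = 1 then [Some 4] else [Some 4] @ replicate (m - 2) None @ [Some 12])
     @ (if n = 1 then [Some 4] else [Some 12] @ replicate (n - 2) None @ [Some 4])"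
proof -
  have const: "map (edge_label m n) [a..<b] = replicate (b - a) None"
    if inner: "\<And>k. a \<le> k \<Longrightarrow> k < b \<Longrightarrow> k \<noteq> 0 \<and> k + 1 \<noteq> m + n \<and> k \<noteq> m \<and> k + 1 \<noteq> m" for a b
  proof -
    have "edge_label m n k = None" if "a \<le> k" "k < b" for k
      using inner[OF that] by (simp add: edge_label_def label_def)
    then show ?thesis by (intro replicate_eqI) auto
  qed
  have "map (edge_label m n) [0..<m] = (if m = 1 then [Some 4] else [Some 4] @ replicate (m - 2) None @ [Some 12])"
  proof (cases "m = 1")
    case False
    then have "[0..<m] = [0] @ [1..<m - 1] @ [m - 1]"
      using pos by (cases m) (auto simp: upt_conv_Cons)
    moreover have "map (edge_label m n) [1..<m - 1] = replicate (m - 1 - 1) None"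
      by (rule const) auto
    moreover have "m - 1 - 1 = m - 2" by simp
    ultimately show ?thesis
      using False pos by (simp add: edge_label_def label_def)
  qed (simp add: edge_label_def label_def)
  moreover have "map (edge_label m n) [m..<m + n] = (if n = 1 then [Some 4] else [Some 12] @ replicate (n - 2) None @ [Some 4])"
  proof (cases "n = 1")
    case False
    then have "[m..<m + n] = [m] @ [m + 1..<m + n - 1] @ [m + n - 1]"
      using pos by (cases n) (auto simp: upt_conv_Cons)
    moreover have "map (edge_label m n) [m + 1..<m + n - 1] = replicate (m + n - 1 - (m + 1)) None"
      by (rule const) auto
    moreover have "m + n - 1 - (m + 1) = n - 2" by simp
    ultimately show ?thesis
      using False pos by (simp add: edge_label_def label_def)
  qed (use pos in \<open>simp add: edge_label_def label_def\<close>)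
  ultimately show ?thesis
    using upt_add_eq_append[of 0 m n] by simp
qed

end

theorem theorem5p4:
  fixes m n :: nat
  assumes "m > 0" and "n > 0"
  shows
    "(m + n \<ge> 4 \<longrightarrow>
        is_chain (spo_coxeter_graph m n :: 'k::{alg_closed_field, field_char_0} borel_map labelled_graph)
          ([r_bar1 m n] @ map (r_\<delta>\<delta> m n) [1..<m] @ [r_\<delta>\<epsilon> m n]
             @ map (r_\<epsilon>\<epsilon> m n) [1..<n] @ [r_last m n])
          ((if m = 1 then [Some 4] else [Some 4] @ replicate (m - 2) None @ [Some 12])
             @ (if n = 1 then [Some 4] else [Some 12] @ replicate (n - 2) None @ [Some 4])))
   \<and> (m + n < 4 \<longrightarrow>
        (m = 1 \<and> n = 1 \<longrightarrow>
           is_chain (spo_coxeter_graph 1 1 :: 'k borel_map labelled_graph)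
             [r_bar1 1 1, r_\<delta>\<epsilon> 1 1, r_last 1 1]
             [Some 4, Some 4])
      \<and> (m = 1 \<and> n = 2 \<longrightarrow>
           is_chain (spo_coxeter_graph 1 2 :: 'k borel_map labelled_graph)
             [r_bar1 1 2, r_\<delta>\<epsilon> 1 2, r_\<epsilon>\<epsilon> 1 2 1, r_last 1 2]
             [Some 4, Some 12, Some 4])
      \<and> (m = 2 \<and> n = 1 \<longrightarrow>
           is_chain (spo_coxeter_graph 2 1 :: 'k borel_map labelled_graph)
             [r_bar1 2 1, r_\<delta>\<delta> 2 1 1, r_\<delta>\<epsilon> 2 1, r_last 2 1]
             [Some 4, Some 12, Some 4]))"
proof -
  have chain: "is_chain (spo_coxeter_graph m n :: 'k borel_map labelled_graph)
      ([r_bar1 m n] @ map (r_\<delta>\<delta> m n) [1..<m] @ [r_\<delta>\<epsilon> m n] @ map (r_\<epsilon>\<epsilon> m n) [1..<n] @ [r_last m n])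
      ((if m = 1 then [Some 4] else [Some 4] @ replicate (m - 2) None @ [Some 12])
        @ (if n = 1 then [Some 4] else [Some 12] @ replicate (n - 2) None @ [Some 4]))"
    if "m > 0" "n > 0" for m n
    using is_chain_chain_map[OF that, where ?'k = 'k]
    unfolding vertices_eq[OF that] edge_labels_eq[OF that] .
  show ?thesis
    using chain[OF assms] chain[of 1 1] chain[of 1 2] chain[of 2 1]
    by (simp add: numeral_2_eq_2)
qed

end
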